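(* Let $d\ge1$, $\alpha\in(0,2)$, and let $f$ be a symmetric probability density on $\mathbb{R}^d$ ($f(-x)=f(x)$). Let $p_n(x)$ be the $n$-step transition probability from $0$ to $x\in\Lambda_{L,d}$ of the circulant random walk on $\Lambda_{L,d}$ with profile $f$ and bandwidth parameter $W$. Assume that for some fixed $x_0\in[0,\frac{L}{2W})^d$ the function $f$ is continuous at $x_0$ with $f(x_0)>0$, and that $f(x)\asymp(\|x\|_2\vee1)^{-d-\alpha}$ on $\mathbb{R}^d$. Then, in the setting $L\to\infty$, $W\to\infty$ (that is, for all sufficiently large $L$ and $W$) and without any further restrictions on $W$, $n\ge1$ and $x\in\Lambda_{L,d}$, there is a constant $C>0$ (independent of $L,W,n,x$) such that $$p_n(x)\le C\left(\frac{1}{n^{d/\alpha}W^d}\wedge\frac{nW^\alpha}{(\|x\|_2\vee W)^{d+\alpha}}+\frac1N\right),$$ where $N=L^d$.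
   Context: Lattice: $\Lambda_{L,d}=\big((-\tfrac L2,\tfrac L2]\cap\mathbb{Z}\big)^d$, $N=|\Lambda_{L,d}|=L^d$; for $x\in\mathbb{Z}^d$, $[x]_L$ is the unique element of $\Lambda_{L,d}$ congruent to $x$ modulo $L$ in every coordinate. Circulant random walk: given a symmetric density $f$ on $\mathbb{R}^d$ and $W>0$, it is the Markov chain on $\Lambda_{L,d}$ with transition matrix $p_1(x,y)=\frac{1}{\Omega_W}f\big(\frac{[y-x]_L}{W}\big)$ for $x\ne y\in\Lambda_{L,d}$ (and $p_1(x,x)=0$), where $\Omega_W=\sum_{0\ne x\in\Lambda_{L,d}}f(x/W)$. Write $p_n(x)=p_n(0,x)$ for the $n$-step transition probability from $0$ to $x$. Notation: $a\vee b=\max\{a,b\}$, $a\wedge b=\min\{a,b\}$; in the bound the minimum is taken of the first two terms and then $1/N$ is added. $f\asymp g$ means $C_1g(x)\le f(x)\le C_2g(x)$ for all $x\in\mathbb{R}^d$ with constants $C_1,C_2>0$. *)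

theory Defs
  imports "HOL-Analysis.Analysis" "HOL-Number_Theory.Cong"
begin

text \<open>The dimension is \<open>d = CARD('d)\<close>; lattice points are vectors in \<open>int ^ 'd\<close>, and the norm
  of \<open>real ^ 'd\<close> is the Euclidean norm.\<close>

definition lattice_box :: "nat \<Rightarrow> (int ^ 'd) set" where
  "lattice_box L = {x. \<forall>i. - (real L / 2) < real_of_int (x $ i) \<and> real_of_int (x $ i) \<le> real L / 2}"

lemma lattice_box_eq:
  "lattice_box L = vec_lambda ` (\<Pi>\<^sub>E i\<in>(UNIV :: 'd::finite set). {- int L div 2 <.. int L div 2})"
proof -
  have eq: "- (real L / 2) < real_of_int k \<and> real_of_int k \<le> real L / 2 \<longleftrightarrow>
        k \<in> {- int L div 2 <.. int L div 2}" for k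
    by simp linarith
  show ?thesis
  proof (intro equalityI subsetI)
    fix x :: "int ^ 'd" assume "x \<in> lattice_box L"
    then have "vec_nth x \<in> (\<Pi>\<^sub>E i\<in>(UNIV :: 'd set). {- int L div 2 <.. int L div 2})"
      using eq unfolding lattice_box_def by blast
    then show "x \<in> vec_lambda ` (\<Pi>\<^sub>E i\<in>(UNIV :: 'd set). {- int L div 2 <.. int L div 2})"
      by (metis image_eqI vec_nth_inverse)
  next
    fix x :: "int ^ 'd"
    assume "x \<in> vec_lambda ` (\<Pi>\<^sub>E i\<in>(UNIV :: 'd set). {- int L div 2 <.. int L div 2})"
    then show "x \<in> lattice_box L"
      using eq unfolding lattice_box_def by fastforce
  qed
qed

lemma finite_lattice_box: "finite (lattice_box L)"
  by (simp add: lattice_box_eq finite_PiE)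

lemma card_lattice_box: "card (lattice_box L :: (int ^ 'd::finite) set) = L ^ CARD('d)"
proof -
  have "card (lattice_box L :: (int ^ 'd) set) =
        card (\<Pi>\<^sub>E i\<in>(UNIV :: 'd set). {- int L div 2 <.. int L div 2})"
    unfolding lattice_box_eq by (intro card_image inj_onI) (metis vec_lambda_inverse UNIV_I)
  also have "\<dots> = nat (int L div 2 - (- int L div 2)) ^ CARD('d)"
    by (simp add: card_PiE)
  also have "int L div 2 - (- int L div 2) = int L"
    by linarith
  finally show ?thesis
    by simp
qed

definition lattice_rep :: "nat \<Rightarrow> int ^ 'd \<Rightarrow> int ^ 'd" where
  "lattice_rep L x = (THE y. y \<in> lattice_box L \<and> (\<forall>i. [y $ i = x $ i] (mod int L)))"

lemma lattice_rep_unique: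
  fixes x :: "int ^ 'd"
  assumes "L > 0"
  shows "\<exists>!y. y \<in> lattice_box L \<and> (\<forall>i. [y $ i = x $ i] (mod int L))"
proof (rule ex_ex1I)
  define r where "r i = (if 2 * (x $ i mod int L) \<le> int L then x $ i mod int L
                         else x $ i mod int L - int L)" for i
  have m: "0 \<le> x $ i mod int L" "x $ i mod int L < int L" for i
    using assms by auto
  have "- int L < 2 * r i \<and> 2 * r i \<le> int L" for i
    using m(1)[of i] m(2)[of i] assms unfolding r_def by (smt (verit) of_nat_0_less_iff)
  then have "- real L < 2 * real_of_int (r i) \<and> 2 * real_of_int (r i) \<le> real L" for i
    by (smt (verit) of_int_add of_int_le_iff of_int_less_iff of_int_minus of_int_of_nat_eq)
  then have "(\<chi> i. r i) \<in> lattice_box L"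
    by (auto simp: lattice_box_def field_simps)
  moreover have "[r i = x $ i] (mod int L)" for i
    by (auto simp: r_def cong_def)
  ultimately show "\<exists>y. y \<in> lattice_box L \<and> (\<forall>i. [y $ i = x $ i] (mod int L))"
    by (intro exI[of _ "\<chi> i. r i"]) auto
next
  fix y z :: "int ^ 'd"
  assume y: "y \<in> lattice_box L \<and> (\<forall>i. [y $ i = x $ i] (mod int L))"
    and z: "z \<in> lattice_box L \<and> (\<forall>i. [z $ i = x $ i] (mod int L))"
  have "y $ i = z $ i" for i
  proof -
    have "[y $ i = z $ i] (mod int L)"
      using y z by (meson cong_sym cong_trans)
    then have "int L dvd y $ i - z $ i"
      by (simp add: cong_iff_dvd_diff)
    moreover have "\<bar>real_of_int (y $ i) - real_of_int (z $ i)\<bar> < real L"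
      using y z unfolding lattice_box_def by (smt (verit) field_sum_of_halves mem_Collect_eq)
    then have "\<bar>y $ i - z $ i\<bar> < int L"
      by linarith
    ultimately have "y $ i - z $ i = 0"
      by (metis abs_of_nat dvd_imp_le_int not_le)
    then show ?thesis
      by simp
  qed
  then show "y = z"
    by (simp add: vec_eq_iff)
qed

definition lattice_vec :: "int ^ 'd \<Rightarrow> real ^ 'd" where
  "lattice_vec x = (\<chi> i. real_of_int (x $ i))"

definition symmetric_prob_density :: "(real ^ 'd \<Rightarrow> real) \<Rightarrow> bool" where
  "symmetric_prob_density f \<longleftrightarrow>
     (\<forall>x. 0 \<le> f x) \<and> has_bochner_integral lebesgue f 1 \<and> (\<forall>x. f (- x) = f x)"

definition comparable :: "(real ^ 'd \<Rightarrow> real) \<Rightarrow> (real ^ 'd \<Rightarrow> real) \<Rightarrow> bool" where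
  "comparable f g \<longleftrightarrow> (\<exists>C1>0. \<exists>C2>0. \<forall>x. C1 * g x \<le> f x \<and> f x \<le> C2 * g x)"

definition Omega :: "(real ^ 'd \<Rightarrow> real) \<Rightarrow> nat \<Rightarrow> real \<Rightarrow> real" where
  "Omega f L W = (\<Sum>x \<in> lattice_box L - {0}. f (lattice_vec x /\<^sub>R W))"

definition step_matrix ::
  "(real ^ 'd \<Rightarrow> real) \<Rightarrow> nat \<Rightarrow> real \<Rightarrow> int ^ 'd \<Rightarrow> int ^ 'd \<Rightarrow> real" where
  "step_matrix f L W x y =
     (if x = y then 0 else f (lattice_vec (lattice_rep L (y - x)) /\<^sub>R W) / Omega f L W)"

text \<open>\<open>trans_prob f L W n x y\<close> is the \<open>n\<close>-step transition probability, that is, the \<open>(x, y)\<close> entry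
  of the \<open>n\<close>-th power of the transition matrix; it is meaningful for \<open>x, y \<in> lattice_box L\<close>.\<close>

primrec trans_prob ::
  "(real ^ 'd \<Rightarrow> real) \<Rightarrow> nat \<Rightarrow> real \<Rightarrow> nat \<Rightarrow> int ^ 'd \<Rightarrow> int ^ 'd \<Rightarrow> real" where
  "trans_prob f L W 0 x y = (if x = y then 1 else 0)"
| "trans_prob f L W (Suc n) x y =
     (\<Sum>z \<in> lattice_box L. trans_prob f L W n x z * step_matrix f L W z y)"

end

theory Submission imports Defs begin

text \<open>
  Why the bound holds. Write \<open>d\<close> for the dimension, \<open>T\<close> for the transition operator acting on functions on
  \<open>\<int>\<^sup>d\<close>, and \<open>q\<close> for its step kernel, so that \<open>p\<^sub>n(x)\<close> is \<open>T\<^sup>n\<close> applied to the indicator of the residue class of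
  \<open>x\<close>, evaluated at \<open>0\<close>. If \<open>W > L/4\<close>, then \<open>q\<close> is bounded by a multiple of \<open>1/N\<close>, which already is the claim
  (\<open>trans_prob_le_if_wide\<close>). Otherwise the normalisation \<open>\<Omega>\<close> is comparable to \<open>W\<^sup>d\<close>, and \<open>q\<close> is pinched
  between multiples of \<open>W\<^sup>\<alpha> (\<bar>x\<bar> \<or> W)\<^bsup>-d-\<alpha>\<^esup>\<close> away from \<open>0\<close>. Everything below follows from this pinching,
  the total mass one and the symmetry of \<open>q\<close>.

  On the diagonal (\<open>on_diagonal_bound\<close>), the lower bound on \<open>q\<close> is a minorisation: with probability of
  order \<open>(W/R)\<^sup>\<alpha>\<close> a step is uniform on the punctured box of radius \<open>R\<close>, and such a step turns any function
  of mass one into a function bounded by \<open>R\<^sup>-\<^sup>d\<close>, up to a constant. With \<open>R\<close> a suitable multiple of \<open>n\<^bsup>1/\<alpha>\<^esup> W\<close>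
  (cut off at \<open>L/4\<close>) the supremum \<open>M\<^sub>n\<close> after \<open>n\<close> steps satisfies
  \<open>M\<^sub>n\<^sub>+\<^sub>1 \<le> (1 - b/n) M\<^sub>n + (b/n) (2/R)\<^sup>d\<close> with \<open>b = d/\<alpha> + 1\<close>, and an induction gives
  \<open>M\<^sub>n \<le> A (n\<^bsup>-d/\<alpha>\<^esup> W\<^sup>-\<^sup>d + 1/N)\<close>.

  Off the diagonal (\<open>off_diagonal_bound\<close>), let \<open>r = \<bar>x\<bar>\<close> and \<open>t = n (W/r)\<^sup>\<alpha> \<le> 1\<close>; the target is
  \<open>t r\<^sup>-\<^sup>d + 1/N\<close>. Paths with a jump longer than \<open>\<rho> = r/K\<close> contribute at most \<open>n\<close> times the largest value of
  \<open>q\<close> at such distances (\<open>one_big_jump\<close>), which is of the right order. A path without such a jump has to travel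
  at least \<open>r/2\<close> during one half of the time. The truncated walk has exponential moments, since \<open>cosh (\<theta> z\<^sub>i)\<close> is
  an eigenfunction of its operator, and choosing \<open>\<theta>\<close> proportional to \<open>log(1/t)/\<rho>\<close> makes the probability of this
  journey \<open>O(t\<^bsup>1 + d/\<alpha>\<^esup>)\<close> (\<open>truncate_tail\<close>). The other half of the time supplies the on-diagonal
  factor (\<open>walk_op_pow_halving\<close>). As \<open>t\<^bsup>d/\<alpha>\<^esup> n\<^bsup>-d/\<alpha>\<^esup> W\<^sup>-\<^sup>d = r\<^sup>-\<^sup>d\<close>, the product is again of the right order.
\<close>

section \<open>The transition operator on functions on the integer lattice\<close>

text \<open>Letting the operator act on functions on all of \<open>\<int>\<^sup>d\<close>, rather than on functions on the torus, makes it commute with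
  honest translations and gives it unbounded eigenfunctions such as \<open>cosh (\<theta> z\<^sub>i)\<close>; the torus reappears by
  applying it to functions that are periodic modulo \<open>L\<close>.\<close>

definition walk_op :: "nat \<Rightarrow> (int ^ 'd \<Rightarrow> real) \<Rightarrow> (int ^ 'd \<Rightarrow> real) \<Rightarrow> int ^ 'd \<Rightarrow> real" where
  "walk_op L q g z = (\<Sum>y\<in>lattice_box L. q y * g (z + y))"

definition residue_ind :: "nat \<Rightarrow> int ^ 'd \<Rightarrow> int ^ 'd \<Rightarrow> real" where
  "residue_ind L x z = of_bool (\<forall>i. [z $ i = x $ i] (mod int L))"

abbreviation lnorm :: "int ^ 'd \<Rightarrow> real" where
  "lnorm x \<equiv> norm (lattice_vec x)"

lemma walk_op_pow_mono:
  assumes "\<And>y. y \<in> lattice_box L \<Longrightarrow> 0 \<le> p y \<and> p y \<le> q y"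
    and "\<And>z. 0 \<le> g z \<and> g z \<le> h z"
  shows "0 \<le> (walk_op L p ^^ n) g z \<and> (walk_op L p ^^ n) g z \<le> (walk_op L q ^^ n) h z"
proof (induction n arbitrary: z)
  case (Suc n)
  show ?case
    unfolding funpow.simps comp_def walk_op_def[of L _ "(_ ^^ _) _"]
    using Suc assms(1)
    by (auto intro!: sum_mono sum_nonneg mult_mono) (meson order_trans)
qed (use assms in auto)

lemma walk_op_pow_sum:
  "(walk_op L q ^^ n) (\<lambda>z. \<Sum>w\<in>I. c w * g w z) z = (\<Sum>w\<in>I. c w * (walk_op L q ^^ n) (g w) z)"
proof (induction n arbitrary: z)
  case (Suc n)
  show ?case
    unfolding funpow.simps comp_def walk_op_def[of L _ "(_ ^^ _) _"] Suc sum_distrib_left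
    by (subst sum.swap) (simp add: mult_ac)
qed auto

lemma walk_op_pow_cmult:
  "(walk_op L q ^^ n) (\<lambda>z. c * g z) z = c * (walk_op L q ^^ n) g z"
  using walk_op_pow_sum[where I = "{()}" and c = "\<lambda>_. c" and g = "\<lambda>_. g"] by simp

lemma walk_op_pow_add:
  "(walk_op L q ^^ n) (\<lambda>z. g z + h z) z = (walk_op L q ^^ n) g z + (walk_op L q ^^ n) h z"
  using walk_op_pow_sum[where I = "{0, 1 :: nat}" and c = "\<lambda>_. 1" and g = "\<lambda>k. if k = 0 then g else h"]
  by simp

lemma walk_op_pow_translate:
  "(walk_op L q ^^ n) (\<lambda>u. g (u + a)) z = (walk_op L q ^^ n) g (z + a)"
proof (induction n arbitrary: z)
  case (Suc n)
  show ?case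
    unfolding funpow.simps comp_def walk_op_def[of L _ "(_ ^^ _) _"] Suc
    by (simp add: add_ac)
qed auto

lemma walk_op_pow_eigen:
  assumes "\<And>z. walk_op L q g z = M * g z"
  shows "(walk_op L q ^^ n) g z = M ^ n * g z"
proof (induction n arbitrary: z)
  case (Suc n)
  have "(walk_op L q ^^ Suc n) g z = M ^ n * walk_op L q g z"
    by (simp add: walk_op_def Suc sum_distrib_left mult_ac)
  then show ?case using assms by simp
qed auto

text \<open>The mass of a function is measured over every translate of the box at once. This is preserved by averaging over
  translates, hence by the operator, and no periodicity has to be tracked.\<close>

lemma walk_op_pow_mass:
  assumes "\<And>y. y \<in> lattice_box L \<Longrightarrow> 0 \<le> q y" and "sum q (lattice_box L) \<le> 1"
    and "\<And>z. (\<Sum>y\<in>lattice_box L. g (z + y)) \<le> \<mu>" and "0 \<le> \<mu>"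
  shows "(\<Sum>y\<in>lattice_box L. (walk_op L q ^^ n) g (z + y)) \<le> \<mu>"
proof (induction n arbitrary: z)
  case (Suc n)
  have "(\<Sum>y\<in>lattice_box L. (walk_op L q ^^ Suc n) g (z + y))
      = (\<Sum>w\<in>lattice_box L. q w * (\<Sum>y\<in>lattice_box L. (walk_op L q ^^ n) g ((z + w) + y)))"
    unfolding funpow.simps comp_def walk_op_def[of L _ "(_ ^^ _) _"] sum_distrib_left
    by (subst sum.swap) (simp add: add_ac)
  also have "\<dots> \<le> (\<Sum>w\<in>lattice_box L. q w * \<mu>)"
    by (intro sum_mono mult_left_mono Suc assms(1))
  also have "\<dots> \<le> \<mu>"
    using mult_right_mono[OF assms(2,4)] by (simp add: sum_distrib_right)
  finally show ?case .
qed (use assms(3) in auto)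

lemma lattice_rep_in_box: "L > 0 \<Longrightarrow> lattice_rep L x \<in> lattice_box L"
  and lattice_rep_cong: "L > 0 \<Longrightarrow> [lattice_rep L x $ i = x $ i] (mod int L)"
  using theI'[OF lattice_rep_unique[of L x]] unfolding lattice_rep_def by auto

lemma lattice_rep_eqI:
  assumes "L > 0" "y \<in> lattice_box L" "\<And>i. [y $ i = x $ i] (mod int L)"
  shows "lattice_rep L x = y"
  unfolding lattice_rep_def
  by (rule the1_equality[OF lattice_rep_unique[OF assms(1)]]) (use assms in auto)

lemma lattice_rep_of_box: "L > 0 \<Longrightarrow> x \<in> lattice_box L \<Longrightarrow> lattice_rep L x = x"
  by (rule lattice_rep_eqI) auto

lemma lattice_rep_congruent:
  assumes "L > 0" "\<And>i. [x $ i = y $ i] (mod int L)"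
  shows "lattice_rep L x = lattice_rep L y"
proof (rule lattice_rep_eqI[OF assms(1) lattice_rep_in_box[OF assms(1)]])
  show "[lattice_rep L y $ i = x $ i] (mod int L)" for i
    by (rule cong_trans[OF lattice_rep_cong[OF assms(1)] cong_sym[OF assms(2)]])
qed

lemma residue_ind_eq: "L > 0 \<Longrightarrow> residue_ind L x z = of_bool (lattice_rep L z = lattice_rep L x)"
proof -
  assume L: "L > 0"
  have "[z $ i = x $ i] (mod int L)" if "lattice_rep L z = lattice_rep L x" for i
    using cong_trans[OF cong_sym[OF lattice_rep_cong[OF L, of z i]]] lattice_rep_cong[OF L, of x i]
    by (simp add: that)
  then show ?thesis
    unfolding residue_ind_def using lattice_rep_congruent[OF L, of z x] by auto
qed

lemma sum_residue_ind:
  assumes "L > 0"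
  shows "(\<Sum>y\<in>lattice_box L. h y * residue_ind L x (z + y)) = h (lattice_rep L (x - z))"
proof -
  have "residue_ind L x (z + y) = of_bool (y = lattice_rep L (x - z))" if "y \<in> lattice_box L" for y
  proof -
    have "(\<forall>i. [(z + y) $ i = x $ i] (mod int L)) \<longleftrightarrow> (\<forall>i. [y $ i = (x - z) $ i] (mod int L))"
      by (simp add: cong_iff_dvd_diff algebra_simps)
    also have "\<dots> \<longleftrightarrow> y = lattice_rep L (x - z)"
      using lattice_rep_eqI[OF assms that, of "x - z"] lattice_rep_cong[OF assms, of "x - z"] by auto
    finally show ?thesis unfolding residue_ind_def by simp
  qed
  then have "(\<Sum>y\<in>lattice_box L. h y * residue_ind L x (z + y))
    = (\<Sum>y\<in>lattice_box L. if y = lattice_rep L (x - z) then h y else 0)"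
    by (intro sum.cong) auto
  also have "\<dots> = h (lattice_rep L (x - z))"
    using assms by (simp add: finite_lattice_box lattice_rep_in_box)
  finally show ?thesis .
qed

lemma lattice_rep_diff_nonzero:
  assumes "L > 0" "x \<in> lattice_box L" "y \<in> lattice_box L" "x \<noteq> y"
  shows "lattice_rep L (y - x) \<noteq> 0"
proof
  assume "lattice_rep L (y - x) = 0"
  then have "[0 = y $ i - x $ i] (mod int L)" for i
    using lattice_rep_cong[OF assms(1), of "y - x" i] by simp
  then have "[x $ i = y $ i] (mod int L)" for i
    using cong_diff_iff_cong_0[of "y $ i" "x $ i" "int L"] by (simp add: cong_sym_eq)
  then show False
    using assms lattice_rep_congruent[of L x y] by (simp add: lattice_rep_of_box)
qed

text \<open>One application of the operator to the indicator of the class of \<open>y\<close> gives the combination of class indicators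
  with coefficients \<open>step_matrix f L W w y\<close>; linearity then reproduces the recursion of \<open>trans_prob\<close>.\<close>

lemma trans_prob_eq_walk_op:
  assumes "L > 0" "x \<in> lattice_box L" "y \<in> lattice_box L"
  shows "trans_prob f L W n x y = (walk_op L (step_matrix f L W 0) ^^ n) (residue_ind L y) x"
  using assms(3)
proof (induction n arbitrary: y)
  case 0
  then show ?case
    using assms by (simp add: residue_ind_eq lattice_rep_of_box)
next
  case (Suc n)
  let ?q = "step_matrix f L W 0"
  have z0: "0 \<in> lattice_box L" using assms(1) by (auto simp: lattice_box_def)
  have step: "step_matrix f L W w y = ?q (lattice_rep L (y - w))" if "w \<in> lattice_box L" for w
    using lattice_rep_diff_nonzero[OF assms(1) that Suc.prems] assms(1) lattice_rep_of_box[OF _ z0]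
    by (cases "w = y") (auto simp: step_matrix_def lattice_rep_of_box lattice_rep_in_box)
  have "walk_op L ?q (residue_ind L y) =
     (\<lambda>z. \<Sum>w\<in>lattice_box L. step_matrix f L W w y * residue_ind L w z)"
  proof
    fix z
    have "(\<Sum>w\<in>lattice_box L. step_matrix f L W w y * residue_ind L w z) =
       (\<Sum>w\<in>lattice_box L. if w = lattice_rep L z then step_matrix f L W w y else 0)"
      using assms(1) by (intro sum.cong) (auto simp: residue_ind_eq lattice_rep_of_box)
    also have "\<dots> = step_matrix f L W (lattice_rep L z) y"
      using assms(1) by (simp add: finite_lattice_box lattice_rep_in_box)
    also have "\<dots> = ?q (lattice_rep L (y - lattice_rep L z))"
      using assms(1) by (intro step lattice_rep_in_box)
    also have "lattice_rep L (y - lattice_rep L z) = lattice_rep L (y - z)"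
      using assms(1) by (intro lattice_rep_congruent) (auto intro!: cong_diff lattice_rep_cong)
    also have "?q \<dots> = walk_op L ?q (residue_ind L y) z"
      unfolding walk_op_def by (rule sum_residue_ind[OF assms(1), symmetric])
    finally show "walk_op L ?q (residue_ind L y) z =
     (\<Sum>w\<in>lattice_box L. step_matrix f L W w y * residue_ind L w z)" by simp
  qed
  then have "(walk_op L ?q ^^ Suc n) (residue_ind L y) x
     = (\<Sum>w\<in>lattice_box L. step_matrix f L W w y * (walk_op L ?q ^^ n) (residue_ind L w) x)"
    by (simp add: funpow_Suc_right walk_op_pow_sum del: funpow.simps)
  then show ?case by (simp add: Suc.IH mult_ac del: funpow.simps)
qed

text \<open>The representative is the element of its class with the smallest coordinates in absolute value. So the torus walk can be far from \<open>0\<close>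
  only if its lift to \<open>\<int>\<^sup>d\<close> is.\<close>

lemma abs_lattice_rep_le:
  assumes "L > 0"
  shows "\<bar>lattice_rep L z $ i\<bar> \<le> \<bar>z $ i\<bar>"
proof (rule ccontr)
  assume *: "\<not> ?thesis"
  define y where "y = lattice_rep L z $ i"
  have "- (real L / 2) < real_of_int y" "real_of_int y \<le> real L / 2"
    using lattice_rep_in_box[OF assms, of z] by (auto simp: y_def lattice_box_def)
  then have "2 * \<bar>y\<bar> \<le> int L" by linarith
  with * have "\<bar>y - z $ i\<bar> < int L" unfolding y_def by linarith
  moreover have "int L dvd y - z $ i"
    using lattice_rep_cong[OF assms, of z i] by (simp add: y_def cong_iff_dvd_diff)
  ultimately have "y = z $ i"
    using dvd_imp_le_int[of "y - z $ i" "int L"] by auto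
  with * show False by (simp add: y_def)
qed

lemma lnorm_mono: "(\<And>i. \<bar>x $ i\<bar> \<le> \<bar>y $ i\<bar>) \<Longrightarrow> lnorm x \<le> lnorm y"
  by (rule norm_le_componentwise_cart) (simp add: lattice_vec_def flip: of_int_abs)

lemma lnorm_triangle: "lnorm (x + y) \<le> lnorm x + lnorm y"
proof -
  have "lattice_vec (x + y) = lattice_vec x + lattice_vec y"
    by (simp add: lattice_vec_def vec_eq_iff)
  then show ?thesis by (simp add: norm_triangle_ineq)
qed

lemma lnorm_lattice_rep_triangle:
  assumes "L > 0" "x \<in> lattice_box L"
  shows "lnorm x \<le> lnorm (lattice_rep L (x - z)) + lnorm (lattice_rep L z)"
proof -
  have "x = lattice_rep L x" using assms by (simp add: lattice_rep_of_box)
  also have "\<dots> = lattice_rep L (lattice_rep L (x - z) + lattice_rep L z)"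
  proof (rule lattice_rep_congruent[OF assms(1)])
    fix i
    have "[lattice_rep L (x - z) $ i + lattice_rep L z $ i = (x - z) $ i + z $ i] (mod int L)"
      by (intro cong_add lattice_rep_cong assms)
    then show "[x $ i = (lattice_rep L (x - z) + lattice_rep L z) $ i] (mod int L)"
      by (simp add: cong_sym)
  qed
  finally have "lnorm x \<le> lnorm (lattice_rep L (x - z) + lattice_rep L z)"
    using lnorm_mono[OF abs_lattice_rep_le[OF assms(1)]] by metis
  then show ?thesis using lnorm_triangle order_trans by blast
qed

lemma in_lattice_boxI:
  assumes "\<And>i. \<bar>real_of_int (x $ i)\<bar> < real L / 2"
  shows "x \<in> lattice_box L"
proof -
  have "- (real L / 2) < real_of_int (x $ i) \<and> real_of_int (x $ i) \<le> real L / 2" for i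
    using assms[of i] by linarith
  then show ?thesis by (simp add: lattice_box_def)
qed

lemma lattice_vec_0 [simp]: "lattice_vec 0 = 0"
  by (simp add: lattice_vec_def vec_eq_iff)

lemma lattice_vec_eq_0_iff [simp]: "lattice_vec x = 0 \<longleftrightarrow> x = 0"
  by (simp add: lattice_vec_def vec_eq_iff)

lemma component_le_lnorm: "\<bar>real_of_int (x $ i)\<bar> \<le> lnorm x"
  using component_le_norm_cart[of "lattice_vec x" i] by (simp add: lattice_vec_def)

lemma lnorm_ge_1: "x \<noteq> 0 \<Longrightarrow> 1 \<le> lnorm x"
proof -
  assume "x \<noteq> 0"
  then obtain i where "x $ i \<noteq> 0" by (auto simp: vec_eq_iff)
  then have "1 \<le> \<bar>real_of_int (x $ i)\<bar>" by linarith
  then show ?thesis using component_le_lnorm[of x i] by linarith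
qed

lemma lnorm_le_sqrt:
  fixes x :: "int ^ 'd"
  assumes "\<And>i. \<bar>real_of_int (x $ i)\<bar> \<le> R" "0 \<le> R"
  shows "lnorm x \<le> sqrt (real CARD('d)) * R"
proof -
  have "lnorm x \<le> norm (\<chi> i::'d. R)"
    using assms by (intro norm_le_componentwise_cart) (simp add: lattice_vec_def)
  also have "\<dots> = sqrt (real CARD('d)) * R"
    using assms by (simp add: norm_vec_def L2_set_def real_sqrt_mult)
  finally show ?thesis .
qed

text \<open>The symmetric box with sides \<open>2 m + 1\<close> is the lattice box of odd size \<open>2 m + 1\<close>, whose cardinality is known.\<close>

lemma int_vec_box:
  fixes m :: nat
  shows finite_int_vec_box: "finite {x :: int ^ 'd. \<forall>i. \<bar>x $ i\<bar> \<le> int m}"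
    and card_int_vec_box: "card {x :: int ^ 'd. \<forall>i. \<bar>x $ i\<bar> \<le> int m} = (2 * m + 1) ^ CARD('d)"
proof -
  have "\<bar>k\<bar> \<le> int m \<longleftrightarrow>
      - (real (2 * m + 1) / 2) < real_of_int k \<and> real_of_int k \<le> real (2 * m + 1) / 2" for k
  proof -
    have "\<bar>k\<bar> \<le> int m \<longleftrightarrow> - (2 * int m + 1) < 2 * k \<and> 2 * k \<le> 2 * int m + 1"
      by linarith
    also have "\<dots> \<longleftrightarrow> real_of_int (- (2 * int m + 1)) < real_of_int (2 * k) \<and>
        real_of_int (2 * k) \<le> real_of_int (2 * int m + 1)"
      by (simp only: of_int_less_iff of_int_le_iff)
    finally show ?thesis by (simp add: field_simps)
  qed
  then have "{x :: int ^ 'd. \<forall>i. \<bar>x $ i\<bar> \<le> int m} = lattice_box (2 * m + 1)"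
    unfolding lattice_box_def by simp
  then show "finite {x :: int ^ 'd. \<forall>i. \<bar>x $ i\<bar> \<le> int m}"
    and "card {x :: int ^ 'd. \<forall>i. \<bar>x $ i\<bar> \<le> int m} = (2 * m + 1) ^ CARD('d)"
    using card_lattice_box[of "2 * m + 1", where 'd = 'd] finite_lattice_box by auto
qed

section \<open>Lattice sums of powers of the norm\<close>

lemma lnorm_ball_subset:
  fixes R :: real
  assumes "0 \<le> R"
  shows "{x :: int ^ 'd. lnorm x \<le> R} \<subseteq> {x. \<forall>i. \<bar>x $ i\<bar> \<le> int (nat \<lfloor>R\<rfloor>)}"
proof (intro subsetI CollectI allI)
  fix x :: "int ^ 'd" and i
  assume "x \<in> {x. lnorm x \<le> R}"
  then have "\<bar>real_of_int (x $ i)\<bar> \<le> R"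
    using component_le_lnorm[of x i] by simp
  then show "\<bar>x $ i\<bar> \<le> int (nat \<lfloor>R\<rfloor>)"
    using assms by (simp add: le_floor_iff)
qed

lemma finite_lnorm_ball: "finite {x :: int ^ 'd. lnorm x \<le> R}"
proof (cases "0 \<le> R")
  case True
  then show ?thesis
    using finite_subset[OF lnorm_ball_subset finite_int_vec_box] by blast
next
  case False
  then have "{x :: int ^ 'd. lnorm x \<le> R} = {}"
    by (auto simp: not_le intro: less_le_trans)
  then show ?thesis by simp
qed

lemma card_lnorm_ball_le:
  assumes "1 \<le> R"
  shows "real (card {x :: int ^ 'd. lnorm x \<le> R}) \<le> (3 * R) ^ CARD('d)"
proof -
  let ?m = "nat \<lfloor>R\<rfloor>"
  have "card {x :: int ^ 'd. lnorm x \<le> R} \<le> (2 * ?m + 1) ^ CARD('d)"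
    using card_mono[OF finite_int_vec_box lnorm_ball_subset[of R]] assms
    unfolding card_int_vec_box by simp
  then have "real (card {x :: int ^ 'd. lnorm x \<le> R}) \<le> real (2 * ?m + 1) ^ CARD('d)"
    by (metis of_nat_le_iff of_nat_power)
  also have "\<dots> \<le> (3 * R) ^ CARD('d)"
    using assms by (intro power_mono) (auto, linarith)
  finally show ?thesis .
qed

text \<open>For \<open>R \<ge> 1\<close> the integer part of \<open>R\<close> is at least \<open>R/2\<close>, and removing the origin costs only one of the many points
  that separate \<open>(2 m + 1)\<^sup>d\<close> from \<open>m\<^sup>d\<close>.\<close>

lemma card_punctured_box_ge:
  assumes "1 \<le> R"
  shows "(R / 2) ^ CARD('d) \<le> real (card {x :: int ^ 'd. x \<noteq> 0 \<and> (\<forall>i. \<bar>real_of_int (x $ i)\<bar> \<le> R)})"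
proof -
  define m where "m = nat \<lfloor>R\<rfloor>"
  have "1 \<le> \<lfloor>R\<rfloor>" using assms by simp
  then have m: "R / 2 \<le> real m" unfolding m_def by linarith
  have "\<bar>k\<bar> \<le> int m \<longleftrightarrow> \<bar>real_of_int k\<bar> \<le> R" for k
    using assms unfolding m_def by (simp add: le_floor_iff)
  then have "{x :: int ^ 'd. x \<noteq> 0 \<and> (\<forall>i. \<bar>real_of_int (x $ i)\<bar> \<le> R)}
      = {x. \<forall>i. \<bar>x $ i\<bar> \<le> int m} - {0}" by auto
  then have c: "card {x :: int ^ 'd. x \<noteq> 0 \<and> (\<forall>i. \<bar>real_of_int (x $ i)\<bar> \<le> R)}
      = (2 * m + 1) ^ CARD('d) - 1"
    by (simp add: finite_int_vec_box card_int_vec_box card_Diff_singleton)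
  have "m ^ CARD('d) < (2 * m + 1) ^ CARD('d)"
    by (intro power_strict_mono) auto
  then have "m ^ CARD('d) \<le> (2 * m + 1) ^ CARD('d) - 1" by simp
  then have "real m ^ CARD('d) \<le> real ((2 * m + 1) ^ CARD('d) - 1)"
    by (metis of_nat_le_iff of_nat_power)
  moreover have "(R / 2) ^ CARD('d) \<le> real m ^ CARD('d)"
    using m assms by (intro power_mono) auto
  ultimately show ?thesis unfolding c by linarith
qed

text \<open>A dyadic shell of radius \<open>R\<close> has at most \<open>(3 R)\<^sup>d\<close> points. If \<open>R < 1\<close> that count fails, but then the shell
  contains no lattice point at all.\<close>

lemma shell_sum_le:
  fixes A :: "(int ^ 'd) set"
  assumes "0 < \<alpha>" "0 < R" and A: "\<And>x. x \<in> A \<Longrightarrow> R / 2 < lnorm x \<and> lnorm x \<le> R"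
  shows "(\<Sum>x\<in>A. lnorm x powr (- real CARD('d) - \<alpha>))
    \<le> 3 ^ CARD('d) * 2 powr (real CARD('d) + \<alpha>) * R powr (- \<alpha>)"
proof (cases "R < 1")
  case True
  have "A = {}"
  proof (rule ccontr)
    assume "A \<noteq> {}"
    then obtain x where x: "x \<in> A" by auto
    then have "x \<noteq> 0" using A[of x] assms(2) lattice_vec_eq_0_iff[of x] by fastforce
    then show False using A[OF x] lnorm_ge_1[of x] True by linarith
  qed
  then show ?thesis by simp
next
  case False
  let ?s = "- real CARD('d) - \<alpha>"
  have "(\<Sum>x\<in>A. lnorm x powr ?s) \<le> (\<Sum>x\<in>A. (R / 2) powr ?s)"
    using A assms by (intro sum_mono powr_mono2') (auto intro: less_imp_le)
  also have "\<dots> = real (card A) * (R / 2) powr ?s" by simp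
  also have "\<dots> \<le> (3 * R) ^ CARD('d) * (R / 2) powr ?s"
  proof (rule mult_right_mono)
    have "card A \<le> card {x :: int ^ 'd. lnorm x \<le> R}"
      using A by (intro card_mono finite_lnorm_ball) auto
    then show "real (card A) \<le> (3 * R) ^ CARD('d)"
      using card_lnorm_ball_le[of R, where 'd = 'd] False by linarith
  qed simp
  also have "(3 * R) ^ CARD('d) = 3 ^ CARD('d) * R powr real CARD('d)"
    using assms by (simp add: power_mult_distrib powr_realpow)
  also have "(R / 2) powr ?s = R powr ?s * 2 powr (real CARD('d) + \<alpha>)"
    using assms by (simp add: powr_divide powr_diff powr_minus powr_add field_simps)
  also have "3 ^ CARD('d) * R powr real CARD('d) * (R powr ?s * 2 powr (real CARD('d) + \<alpha>))
      = 3 ^ CARD('d) * 2 powr (real CARD('d) + \<alpha>) * (R powr real CARD('d) * R powr ?s)"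
    by (simp add: mult_ac)
  also have "R powr real CARD('d) * R powr ?s = R powr (- \<alpha>)"
    by (simp flip: powr_add)
  finally show ?thesis .
qed

text \<open>Peeling off the shell between \<open>R\<close> and \<open>2 R\<close> leaves a tail of radius \<open>2 R\<close>, so the constant has to satisfy
  \<open>T = D + 2\<^bsup>-\<alpha>\<^esup> T\<close>, which \<open>\<alpha> > 0\<close> makes solvable.\<close>

lemma tail_sum_le:
  assumes "0 < \<alpha>"
  shows "\<exists>T>0. \<forall>(A :: (int ^ 'd) set) R. finite A \<longrightarrow> 0 < R \<longrightarrow> (\<forall>x\<in>A. R < lnorm x) \<longrightarrow>
    (\<Sum>x\<in>A. lnorm x powr (- real CARD('d) - \<alpha>)) \<le> T * R powr (- \<alpha>)"
proof -
  define D where "D = 3 ^ CARD('d) * 2 powr (real CARD('d) + \<alpha>) * 2 powr (- \<alpha>)"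
  define T where "T = D / (1 - 2 powr (- \<alpha>))"
  let ?g = "\<lambda>x :: int ^ 'd. lnorm x powr (- real CARD('d) - \<alpha>)"
  have p: "2 powr (- \<alpha>) < 1" using assms powr_less_one[of 2 "-\<alpha>"] by simp
  have "0 < D" by (simp add: D_def)
  then have T: "0 < T" using p by (simp add: T_def)
  have "T * (1 - 2 powr (- \<alpha>)) = D" using p assms by (simp add: T_def)
  then have TD: "D + T * 2 powr (- \<alpha>) = T" by (simp add: algebra_simps)
  have *: "sum ?g A \<le> T * R powr (- \<alpha>)"
    if "finite A" "0 < R" "\<And>x. x \<in> A \<Longrightarrow> R < lnorm x \<and> lnorm x \<le> 2 ^ k * R" for A R k
    using that
  proof (induction k arbitrary: A R)
    case 0
    then have "A = {}" by force
    then show ?case using T by simp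
  next
    case (Suc k)
    let ?N = "{x\<in>A. lnorm x \<le> 2 * R}" and ?F = "{x\<in>A. 2 * R < lnorm x}"
    have "sum ?g A = sum ?g ?N + sum ?g ?F"
      using Suc.prems(1) by (subst sum.union_disjoint[symmetric]) (auto intro!: sum.cong)
    also have "sum ?g ?N \<le> D * R powr (- \<alpha>)"
      using shell_sum_le[OF assms, of "2 * R" ?N] Suc.prems
      by (simp add: D_def powr_mult mult_ac)
    also have "sum ?g ?F \<le> T * (2 * R) powr (- \<alpha>)"
      using Suc.prems by (intro Suc.IH) (auto simp: mult_ac)
    also have "D * R powr (- \<alpha>) + T * (2 * R) powr (- \<alpha>) = (D + T * 2 powr (- \<alpha>)) * R powr (- \<alpha>)"
      using Suc.prems by (simp add: powr_mult algebra_simps)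
    also note TD
    finally show ?case by simp
  qed
  show ?thesis
  proof (intro exI[of _ T] conjI T allI impI)
    fix A :: "(int ^ 'd) set" and R :: real
    assume A: "finite A" "0 < R" "\<forall>x\<in>A. R < lnorm x"
    obtain k :: nat where k: "Max (insert 0 (lnorm ` A)) / R < 2 ^ k"
      using real_arch_pow[of 2] by auto
    show "sum ?g A \<le> T * R powr (- \<alpha>)"
    proof (rule *[OF A(1,2)])
      fix x assume "x \<in> A"
      then have "lnorm x \<le> Max (insert 0 (lnorm ` A))" using A by simp
      also have "\<dots> \<le> 2 ^ k * R" using k A(2) by (simp add: field_simps)
      finally show "R < lnorm x \<and> lnorm x \<le> 2 ^ k * R" using A \<open>x \<in> A\<close> by auto
    qed
  qed
qed

text \<open>The same peeling, now inwards from \<open>R\<close> to \<open>R/2\<close>. The constant satisfies \<open>T = D + 2\<^bsup>\<alpha>-2\<^esup> T\<close>; this is where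
  \<open>\<alpha> < 2\<close> enters.\<close>

lemma second_moment_sum_le:
  assumes "0 < \<alpha>" "\<alpha> < 2"
  shows "\<exists>T>0. \<forall>(A :: (int ^ 'd) set) R. 0 < R \<longrightarrow> (\<forall>x\<in>A. x \<noteq> 0 \<and> lnorm x \<le> R) \<longrightarrow>
    (\<Sum>x\<in>A. (lnorm x)\<^sup>2 * lnorm x powr (- real CARD('d) - \<alpha>)) \<le> T * R powr (2 - \<alpha>)"
proof -
  define D where "D = 3 ^ CARD('d) * 2 powr (real CARD('d) + \<alpha>)"
  define T where "T = D / (1 - 2 powr (\<alpha> - 2))"
  let ?h = "\<lambda>x :: int ^ 'd. lnorm x powr (- real CARD('d) - \<alpha>)"
  let ?g = "\<lambda>x :: int ^ 'd. (lnorm x)\<^sup>2 * ?h x"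
  have p: "2 powr (\<alpha> - 2) < 1" using assms powr_less_one[of 2 "\<alpha> - 2"] by simp
  have "0 < D" by (simp add: D_def)
  then have T: "0 < T" using p by (simp add: T_def)
  have "T * (1 - 2 powr (\<alpha> - 2)) = D" using p assms by (simp add: T_def)
  then have TD: "D + T * 2 powr (\<alpha> - 2) = T" by (simp add: algebra_simps)
  have *: "sum ?g A \<le> T * R powr (2 - \<alpha>)"
    if "0 < R" "\<And>x. x \<in> A \<Longrightarrow> x \<noteq> 0 \<and> lnorm x \<le> R" "R < 2 ^ k" for A R and k :: nat
    using that
  proof (induction k arbitrary: A R)
    case 0
    then have "A = {}" using lnorm_ge_1 by fastforce
    then show ?case using T by simp
  next
    case (Suc k)
    let ?N = "{x\<in>A. lnorm x \<le> R / 2}" and ?F = "{x\<in>A. R / 2 < lnorm x}"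
    have fin: "finite A"
      by (rule finite_subset[OF _ finite_lnorm_ball[of R]]) (use Suc.prems in auto)
    have "sum ?g A = sum ?g ?F + sum ?g ?N"
      using fin by (subst sum.union_disjoint[symmetric]) (auto intro!: sum.cong)
    also have "sum ?g ?N \<le> T * (R / 2) powr (2 - \<alpha>)"
      using Suc.prems by (intro Suc.IH) auto
    also have "sum ?g ?F \<le> (\<Sum>x\<in>?F. R\<^sup>2 * ?h x)"
      using Suc.prems by (intro sum_mono mult_right_mono power_mono) auto
    also have "\<dots> \<le> R\<^sup>2 * (D * R powr (- \<alpha>))"
      unfolding sum_distrib_left[symmetric] D_def
      using Suc.prems by (intro mult_left_mono shell_sum_le[OF assms(1)]) auto
    also have "R\<^sup>2 * (D * R powr (- \<alpha>)) = D * R powr (2 - \<alpha>)"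
      using Suc.prems by (simp add: powr_diff powr_minus powr_numeral field_simps)
    also have "D * R powr (2 - \<alpha>) + T * (R / 2) powr (2 - \<alpha>) = (D + T * 2 powr (\<alpha> - 2)) * R powr (2 - \<alpha>)"
      using Suc.prems by (simp add: powr_divide powr_diff powr_minus field_simps)
    also note TD
    finally show ?case by simp
  qed
  show ?thesis
  proof (intro exI[of _ T] conjI T allI impI)
    fix A :: "(int ^ 'd) set" and R :: real
    assume A: "0 < R" "\<forall>x\<in>A. x \<noteq> 0 \<and> lnorm x \<le> R"
    obtain k :: nat where "R < 2 ^ k"
      using real_arch_pow[of 2] by auto
    with A show "sum ?g A \<le> T * R powr (2 - \<alpha>)" by (intro *) auto
  qed
qed

section \<open>Stable-like kernels and the on-diagonal bound\<close>

text \<open>The properties of the step kernel on which the heat kernel bound rests, in the regime where the box is wider than the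
  range \<open>W\<close>. Since the half-open box is not symmetric, evenness can only be demanded where both points lie in it.\<close>

locale stable_kernel =
  fixes \<alpha> c C :: real and L :: nat and W :: real and q :: "int ^ 'd \<Rightarrow> real"
  assumes alpha: "0 < \<alpha>" "\<alpha> < 2" and constants: "0 < c" "0 < C"
    and W_ge_1: "1 \<le> W" and L_ge: "4 * W \<le> real L"
    and nonneg: "x \<in> lattice_box L \<Longrightarrow> 0 \<le> q x"
    and total: "sum q (lattice_box L) = 1"
    and uniform_upper: "x \<in> lattice_box L \<Longrightarrow> q x \<le> C / W ^ CARD('d)"
    and decay: "x \<in> lattice_box L \<Longrightarrow> x \<noteq> 0 \<Longrightarrow>
      q x \<le> C * W powr \<alpha> * lnorm x powr (- real CARD('d) - \<alpha>)"
    and lower: "W \<le> R \<Longrightarrow> x \<in> lattice_box L \<Longrightarrow> x \<noteq> 0 \<Longrightarrow> (\<And>i. \<bar>real_of_int (x $ i)\<bar> \<le> R) \<Longrightarrow>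
      c * W powr \<alpha> * R powr (- real CARD('d) - \<alpha>) \<le> q x"
    and even: "x \<in> lattice_box L \<Longrightarrow> - x \<in> lattice_box L \<Longrightarrow> q (- x) = q x"

definition spread_bound :: "nat \<Rightarrow> real \<Rightarrow> nat \<Rightarrow> real \<Rightarrow> nat \<Rightarrow> real" where
  "spread_bound d \<alpha> L W n = 1 / (real n powr (real d / \<alpha>) * W ^ d) + 1 / real L ^ d"

lemma walk_op_le_sup_times_mass:
  assumes "\<And>y. y \<in> lattice_box L \<Longrightarrow> q y \<le> K" "0 \<le> K" "\<And>z. 0 \<le> g z"
    and "(\<Sum>y\<in>lattice_box L. g (z + y)) \<le> \<mu>"
  shows "walk_op L q g z \<le> K * \<mu>"
proof -
  have "walk_op L q g z \<le> (\<Sum>y\<in>lattice_box L. K * g (z + y))"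
    unfolding walk_op_def using assms by (intro sum_mono mult_right_mono) auto
  also have "\<dots> \<le> K * \<mu>"
    unfolding sum_distrib_left[symmetric] using assms by (intro mult_left_mono)
  finally show ?thesis .
qed

text \<open>If the kernel dominates \<open>w\<close> on \<open>B\<close>, a step is a mixture: with weight \<open>w * card B\<close> it is uniform on \<open>B\<close>, and the
  uniform average is controlled by the mass instead of the supremum.\<close>

lemma walk_op_le_with_uniform_part:
  fixes q :: "int ^ 'd \<Rightarrow> real"
  assumes "\<And>y. y \<in> lattice_box L \<Longrightarrow> 0 \<le> q y" "sum q (lattice_box L) = 1"
    and "B \<subseteq> lattice_box L" "0 \<le> w" "\<And>y. y \<in> B \<Longrightarrow> w \<le> q y"
    and "\<And>z. 0 \<le> g z" "\<And>z. g z \<le> M" "(\<Sum>y\<in>lattice_box L. g (z + y)) \<le> \<mu>"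
  shows "walk_op L q g z \<le> (1 - w * card B) * M + w * \<mu>"
proof -
  let ?\<Lambda> = "lattice_box L :: (int ^ 'd) set" and ?u = "\<lambda>y. w * of_bool (y \<in> B)"
  have "walk_op L q g z = (\<Sum>y\<in>?\<Lambda>. (q y - ?u y) * g (z + y)) + (\<Sum>y\<in>?\<Lambda>. ?u y * g (z + y))"
    unfolding walk_op_def by (simp add: algebra_simps flip: sum.distrib)
  also have "(\<Sum>y\<in>?\<Lambda>. (q y - ?u y) * g (z + y)) \<le> (\<Sum>y\<in>?\<Lambda>. (q y - ?u y) * M)"
    using assms by (intro sum_mono mult_left_mono) auto
  also have "\<dots> = (1 - w * card B) * M"
    using assms(3) by (simp add: assms(2) sum_subtractf finite_lattice_box Int_absorb1
        flip: sum_distrib_right sum_distrib_left)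
  also have "(\<Sum>y\<in>?\<Lambda>. ?u y * g (z + y)) \<le> (\<Sum>y\<in>?\<Lambda>. w * g (z + y))"
    using assms by (intro sum_mono mult_right_mono) auto
  also have "\<dots> \<le> w * \<mu>"
    unfolding sum_distrib_left[symmetric] using assms by (intro mult_left_mono)
  finally show ?thesis by simp
qed

text \<open>This is Bernoulli's inequality \<open>(1 + 1/n)\<^bsup>-s\<^esup> \<ge> 1 - s/n\<close>: passing from \<open>n\<close> to \<open>n + 1\<close> costs a factor \<open>1 - s/n\<close>,
  which a contraction by \<open>1 - b/n\<close> with \<open>b > s\<close> more than pays for.\<close>

lemma powr_succ_ge:
  fixes s :: real
  assumes "0 \<le> s" "1 \<le> n"
  shows "(1 - s / real n) / real n powr s \<le> 1 / real (Suc n) powr s"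
proof -
  have "ln (1 + 1 / real n) \<le> 1 / real n"
    using ln_add_one_self_le_self[of "1 / real n"] by simp
  then have "- (s / n) \<le> - s * ln (1 + 1 / real n)"
    using mult_left_mono[of "ln (1 + 1 / real n)" "1 / real n" s] assms by simp
  then have "1 - s / n \<le> exp (- s * ln (1 + 1 / real n))"
    using exp_ge_add_one_self[of "- s * ln (1 + 1 / real n)"] by linarith
  also have "\<dots> = (1 + 1 / real n) powr (- s)"
    by (subst powr_def) (use add_pos_nonneg[of 1 "1 / real n"] in simp)
  also have "1 + 1 / real n = real (Suc n) / real n"
    using assms by (simp add: field_simps)
  also have "(real (Suc n) / real n) powr (- s) = real n powr s / real (Suc n) powr s"
    using assms by (simp add: powr_divide powr_minus field_simps del: of_nat_Suc)
  finally have "1 - s / n \<le> real n powr s / real (Suc n) powr s" .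
  then show ?thesis
    using assms by (simp add: field_simps del: of_nat_Suc)
qed

text \<open>The bound is proved for all nonnegative functions of mass at most \<open>\<mu>\<close>, because the off-diagonal argument applies it
  to cut-off functions that are not class indicators. For the first few \<open>n\<close>, as long as \<open>\<epsilon> n\<^bsup>1/\<alpha>\<^esup> < 1\<close>, the
  uniform upper bound on the kernel suffices; after that the box of radius \<open>R \<ge> W\<close> is in the range of the lower
  bound and the recursion for the supremum runs.\<close>

lemma on_diagonal_bound:
  assumes "0 < \<alpha>" "0 < c" "0 < C"
  shows "\<exists>A>0. \<forall>L W (q :: int ^ 'd \<Rightarrow> real) g \<mu> n z. stable_kernel \<alpha> c C L W q \<longrightarrow> 1 \<le> n \<longrightarrow>
    0 \<le> \<mu> \<longrightarrow> (\<forall>z. 0 \<le> g z) \<longrightarrow> (\<forall>z. (\<Sum>y\<in>lattice_box L. g (z + y)) \<le> \<mu>) \<longrightarrow>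
    (walk_op L q ^^ n) g z \<le> A * \<mu> * spread_bound CARD('d) \<alpha> L W n"
proof -
  let ?d = "CARD('d)"
  define s where "s = real ?d / \<alpha>"
  \<comment> \<open>any \<open>b > s\<close> would do; \<open>b - s = 1\<close> keeps the constants simple\<close>
  define b where "b = s + 1"
  \<comment> \<open>chosen so that \<open>R \<le> \<epsilon> n\<^bsup>1/\<alpha>\<^esup> W\<close> implies \<open>q \<ge> (b/n) (2/R)\<^sup>d\<close> on the box of radius \<open>R\<close>\<close>
  define \<epsilon> where "\<epsilon> = (c / (b * 2 ^ ?d)) powr (1 / \<alpha>)"
  define D where "D = 2 ^ ?d / \<epsilon> ^ ?d"
  define A where "A = C * (1 + 2 powr s / \<epsilon> ^ ?d) + b * D + 8 ^ ?d"
  have s: "0 < s" and b: "0 < b" using assms by (auto simp: s_def b_def add_pos_pos)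
  then have \<epsilon>: "0 < \<epsilon>" using assms by (simp add: \<epsilon>_def)
  then have D: "0 < D" by (simp add: D_def)
  have \<epsilon>_powr: "\<epsilon> powr \<alpha> = c / (b * 2 ^ ?d)"
    using assms b by (simp add: \<epsilon>_def powr_powr)
  have A1: "C \<le> A" and A2: "C * (2 powr s / \<epsilon> ^ ?d) \<le> A" and A3: "b * D \<le> A" and A4: "8 ^ ?d \<le> A"
    and A: "0 < A"
    using assms b D \<epsilon> unfolding A_def by (simp_all add: distrib_left add_nonneg_nonneg add_pos_pos)
  have "(walk_op L q ^^ n) g z \<le> A * \<mu> * spread_bound ?d \<alpha> L W n"
    if K: "stable_kernel \<alpha> c C L W q" and n: "1 \<le> n" and \<mu>: "0 \<le> \<mu>" and g: "\<And>z. 0 \<le> g z"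
      and mass: "\<And>z. (\<Sum>y\<in>lattice_box L. g (z + y)) \<le> \<mu>"
    for L W and q :: "int ^ 'd \<Rightarrow> real" and g \<mu> n z
  proof -
    interpret stable_kernel \<alpha> c C L W q by (fact K)
    have W: "0 < W" and L: "4 \<le> real L" using W_ge_1 L_ge by linarith+
    define X where "X n = 1 / (real n powr s * W ^ ?d)" for n
    define Y where "Y = 1 / real L ^ ?d"
    have X0: "0 \<le> X n" for n using W by (simp add: X_def)
    have Y0: "0 \<le> Y" by (simp add: Y_def)
    have g': "0 \<le> (walk_op L q ^^ n) g z" for n z
      using walk_op_pow_mono[of L q q g g] g nonneg by blast
    have mass': "(\<Sum>y\<in>lattice_box L. (walk_op L q ^^ n) g (z + y)) \<le> \<mu>" for n z
      by (intro walk_op_pow_mass nonneg mass \<mu>) (simp_all add: total)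
    have crude: "(walk_op L q ^^ Suc n) g z \<le> C / W ^ ?d * \<mu>" for n z
      using walk_op_le_sup_times_mass[OF uniform_upper _ g' mass'[of n z]] W constants by simp
    from n show ?thesis
      unfolding spread_bound_def s_def[symmetric] X_def[symmetric] Y_def[symmetric]
    proof (induction n arbitrary: z rule: dec_induct)
      case base
      have "(walk_op L q ^^ 1) g z \<le> C * X 1 * \<mu>"
        using crude[of 0 z] by (simp add: X_def)
      also have "\<dots> \<le> A * (X 1 + Y) * \<mu>"
        using A A1 X0 Y0 \<mu> by (intro mult_right_mono mult_mono) auto
      finally show ?case by (simp add: mult_ac)
    next
      case (step n)
      have n: "0 < real n" using step by simp
      show ?case
      proof (cases "\<epsilon> * real n powr (1 / \<alpha>) < 1")
        case True
        have "real (Suc n) powr s \<le> (2 * real n) powr s"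
          using step s by (intro powr_mono2) auto
        also have "\<dots> = 2 powr s * (real n powr (1 / \<alpha>)) ^ ?d"
          using n by (simp add: powr_mult s_def powr_powr flip: powr_realpow)
        also have "\<dots> \<le> 2 powr s * (1 / \<epsilon>) ^ ?d"
          using True \<epsilon> by (intro mult_left_mono power_mono) (auto simp: field_simps)
        finally have "1 \<le> 2 powr s / \<epsilon> ^ ?d / real (Suc n) powr s"
          using \<epsilon> by (subst le_divide_eq) (simp add: power_one_over del: of_nat_Suc)
        then have "C / W ^ ?d * 1 \<le> C / W ^ ?d * (2 powr s / \<epsilon> ^ ?d / real (Suc n) powr s)"
          using W constants by (intro mult_left_mono) auto
        also have "\<dots> = C * (2 powr s / \<epsilon> ^ ?d) * X (Suc n)"
          by (simp add: X_def del: of_nat_Suc)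
        also have "\<dots> \<le> A * (X (Suc n) + Y)"
          using A A2 X0 Y0 by (intro mult_mono) auto
        finally have "C / W ^ ?d * \<mu> \<le> A * (X (Suc n) + Y) * \<mu>"
          using \<mu> by (intro mult_right_mono) auto
        then show ?thesis using crude[of n z] by (simp add: mult_ac)
      next
        case False
        define R where "R = min (\<epsilon> * real n powr (1 / \<alpha>) * W) (real L / 4)"
        define B where "B = {x :: int ^ 'd. x \<noteq> 0 \<and> (\<forall>i. \<bar>real_of_int (x $ i)\<bar> \<le> R)}"
        define w where "w = b / n * (2 / R) ^ ?d"
        have "1 * W \<le> \<epsilon> * real n powr (1 / \<alpha>) * W"
          using False W by (intro mult_right_mono) auto
        then have WR: "W \<le> R" using L_ge by (simp add: R_def)
        then have R: "1 \<le> R" using W_ge_1 by linarith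
        have w0: "0 \<le> w" using b R by (simp add: w_def)
        have B_sub: "B \<subseteq> lattice_box L"
        proof
          fix x assume "x \<in> B"
          then have "\<bar>real_of_int (x $ i)\<bar> \<le> R" for i
            by (simp add: B_def)
          moreover have "R < real L / 2" using L by (simp add: R_def min_def)
          ultimately show "x \<in> lattice_box L"
            by (intro in_lattice_boxI) (rule le_less_trans)
        qed
        have wB: "w \<le> q y" if "y \<in> B" for y
        proof -
          have "R powr \<alpha> \<le> (\<epsilon> * real n powr (1 / \<alpha>) * W) powr \<alpha>"
            using R assms by (intro powr_mono2) (auto simp: R_def)
          also have "\<dots> = c / (b * 2 ^ ?d) * n * W powr \<alpha>"
            using \<epsilon> W n assms by (simp add: powr_mult powr_powr \<epsilon>_powr)
          finally have "b * 2 ^ ?d / n \<le> c * W powr \<alpha> / R powr \<alpha>"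
            using b n R by (simp add: field_simps)
          then have "b * 2 ^ ?d / n * R powr (- real ?d) \<le> c * W powr \<alpha> / R powr \<alpha> * R powr (- real ?d)"
            by (intro mult_right_mono) auto
          then have "w \<le> c * W powr \<alpha> * R powr (- real ?d - \<alpha>)"
            using R by (simp add: w_def power_divide powr_minus powr_diff powr_realpow field_simps)
          also have "\<dots> \<le> q y"
            using that B_sub by (intro lower WR) (auto simp: B_def)
          finally show ?thesis .
        qed
        have "b / n * 1 = w * (R / 2) ^ ?d"
          using R by (simp add: w_def flip: power_mult_distrib)
        also have "\<dots> \<le> w * card B"
          unfolding B_def by (intro mult_left_mono card_punctured_box_ge R w0)
        finally have wcard: "b / n \<le> w * card B" by simp
        \<comment> \<open>a minimum is one of its two arguments, so its inverse is at most the sum of the inverses\<close>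
        have "1 / R ^ ?d \<le> 1 / (\<epsilon> * real n powr (1 / \<alpha>) * W) ^ ?d + 1 / (real L / 4) ^ ?d"
          using \<epsilon> W n L by (simp add: R_def min_def)
        also have "(\<epsilon> * real n powr (1 / \<alpha>) * W) ^ ?d = \<epsilon> ^ ?d * (real n powr s * W ^ ?d)"
          using n by (simp add: power_mult_distrib s_def powr_powr flip: powr_realpow)
        also have "1 / (\<epsilon> ^ ?d * (real n powr s * W ^ ?d)) + 1 / (real L / 4) ^ ?d = X n / \<epsilon> ^ ?d + 4 ^ ?d * Y"
          by (simp add: X_def Y_def power_divide)
        finally have "2 ^ ?d * (1 / R ^ ?d) \<le> 2 ^ ?d * (X n / \<epsilon> ^ ?d + 4 ^ ?d * Y)"
          by (intro mult_left_mono) auto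
        also have "\<dots> = D * X n + 8 ^ ?d * Y"
          by (simp add: D_def distrib_left flip: power_mult_distrib)
        finally have w_le: "w \<le> b / n * (D * X n + 8 ^ ?d * Y)"
          unfolding w_def using b n by (intro mult_left_mono) (auto simp: power_divide)
        have IH: "(walk_op L q ^^ n) g z \<le> A * \<mu> * (X n + Y)" for z by (rule step.IH)
        have M0: "0 \<le> A * \<mu> * (X n + Y)" using A \<mu> X0 Y0 by simp
        have "(walk_op L q ^^ Suc n) g z \<le> (1 - w * card B) * (A * \<mu> * (X n + Y)) + w * \<mu>"
          using walk_op_le_with_uniform_part[OF nonneg total B_sub w0 wB g' IH mass'[of n z]] by simp
        also have "\<dots> \<le> (1 - b / n) * (A * \<mu> * (X n + Y)) + b / n * (D * X n + 8 ^ ?d * Y) * \<mu>"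
          using wcard w_le \<mu> M0 by (intro add_mono mult_right_mono) auto
        also have "\<dots> = \<mu> * (A * (1 - s / n) * X n + (b * D - A) / n * X n + A * Y + b * (8 ^ ?d - A) / n * Y)"
          unfolding b_def using n by (simp add: field_simps)
        also have "\<dots> \<le> \<mu> * (A * ((1 - s / n) * X n) + A * Y)"
        proof (intro mult_left_mono \<mu>)
          have "(b * D - A) / n * X n \<le> 0"
            using A3 n X0[of n] by (intro mult_nonpos_nonneg divide_nonpos_nonneg) auto
          moreover have "b * (8 ^ ?d - A) / n * Y \<le> 0"
            using A4 n Y0 b by (intro mult_nonpos_nonneg divide_nonpos_nonneg mult_nonneg_nonpos) auto
          ultimately show "A * (1 - s / n) * X n + (b * D - A) / n * X n + A * Y + b * (8 ^ ?d - A) / n * Y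
            \<le> A * ((1 - s / n) * X n) + A * Y" by (simp add: mult.assoc)
        qed
        also have "\<dots> \<le> \<mu> * (A * X (Suc n) + A * Y)"
        proof (intro mult_left_mono add_mono \<mu> order_refl)
          have "(1 - s / real n) / real n powr s / W ^ ?d \<le> 1 / real (Suc n) powr s / W ^ ?d"
            using step s W by (intro divide_right_mono powr_succ_ge) auto
          then show "(1 - s / n) * X n \<le> X (Suc n)"
            by (simp add: X_def del: of_nat_Suc)
        qed (use A in auto)
        finally show ?thesis by (simp add: algebra_simps)
      qed
    qed
  qed
  with A show ?thesis by blast
qed

section \<open>Large jumps and exponential moments\<close>

text \<open>What matters is that \<open>cosh u - 1\<close> is quadratic near \<open>0\<close>: only then does the second moment of the truncated kernel
  control its exponential moments.\<close>

lemma cosh_le_one_plus: "cosh u \<le> 1 + u\<^sup>2 * exp \<bar>u\<bar>" for u :: real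
proof -
  have *: "cosh v \<le> 1 + v\<^sup>2 * exp v" if v: "0 \<le> v" for v :: real
  proof -
    have e1: "1 - v \<le> exp (- v)" using exp_ge_add_one_self[of "- v"] by simp
    have e2: "1 + v \<le> exp v" by (rule exp_ge_add_one_self)
    have "(1 - v) * exp v \<le> exp (- v) * exp v"
      by (intro mult_right_mono e1) simp
    then have "exp v - 1 \<le> v * exp v" by (simp add: algebra_simps flip: exp_add)
    then have "v * (exp v - 1) \<le> v * (v * exp v)" using v by (intro mult_left_mono)
    then have a: "v * exp v \<le> v + v\<^sup>2 * exp v" by (simp add: algebra_simps power2_eq_square)
    have "(1 + v) * exp (- v) \<le> exp v * exp (- v)"
      by (intro mult_right_mono e2) simp
    then have "exp (- v) \<le> 1 - v * exp (- v)" by (simp add: algebra_simps flip: exp_add)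
    moreover have "v * exp (- v) \<ge> v * (1 - v)" using v by (intro mult_left_mono e1)
    ultimately have b: "exp (- v) \<le> 1 - v + v\<^sup>2 * 1" by (simp add: algebra_simps power2_eq_square)
    have "v\<^sup>2 * 1 \<le> v\<^sup>2 * exp v" using v by (intro mult_left_mono) auto
    with a b \<open>exp v - 1 \<le> v * exp v\<close> show ?thesis by (simp add: cosh_def)
  qed
  show ?thesis using *[of "\<bar>u\<bar>"] by (simp add: cosh_real_abs)
qed

definition truncate_kernel :: "real \<Rightarrow> (int ^ 'd \<Rightarrow> real) \<Rightarrow> int ^ 'd \<Rightarrow> real" where
  "truncate_kernel \<rho> q y = (if lnorm y \<le> \<rho> then q y else 0)"

definition far_ind :: "nat \<Rightarrow> real \<Rightarrow> int ^ 'd \<Rightarrow> real" where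
  "far_ind L a z = of_bool (a \<le> lnorm (lattice_rep L z))"

lemma lattice_vec_uminus: "lattice_vec (- x) = - lattice_vec x"
  by (simp add: lattice_vec_def vec_eq_iff)

text \<open>Markov's inequality, ready for integration: a point far from \<open>0\<close> has a coordinate of size at least
  \<open>a / sqrt d\<close>.\<close>

lemma far_ind_le_cosh:
  fixes z :: "int ^ 'd"
  assumes "0 < L" "0 \<le> \<theta>" "0 \<le> a"
  shows "far_ind L a z \<le> (\<Sum>i\<in>UNIV. 2 * exp (- \<theta> * a / sqrt (real CARD('d))) * cosh (\<theta> * real_of_int (z $ i)))"
proof (cases "a \<le> lnorm (lattice_rep L z)")
  case True
  let ?r = "lattice_rep L z" and ?D = "sqrt (real CARD('d))"
  have D: "0 < ?D" by simp
  have "\<exists>i. a / ?D \<le> \<bar>real_of_int (z $ i)\<bar>"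
  proof (rule ccontr)
    assume "\<not> ?thesis"
    then have lt: "\<bar>real_of_int (z $ i)\<bar> < a / ?D" for i by (simp add: not_le)
    define M where "M = Max (range (\<lambda>i. \<bar>real_of_int (z $ i)\<bar>))"
    have "\<bar>real_of_int (?r $ i)\<bar> \<le> M" for i
    proof -
      have "\<bar>real_of_int (?r $ i)\<bar> \<le> \<bar>real_of_int (z $ i)\<bar>"
        using abs_lattice_rep_le[OF assms(1), of z i] by linarith
      also have "\<dots> \<le> M" unfolding M_def by (intro Max_ge) auto
      finally show ?thesis .
    qed
    moreover have "M < a / ?D" unfolding M_def using lt by (subst Max_less_iff) auto
    moreover have "0 \<le> M" using calculation(1)[of undefined] by linarith
    ultimately have "lnorm ?r \<le> ?D * M" by (intro lnorm_le_sqrt) auto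
    also have "\<dots> < ?D * (a / ?D)" using \<open>M < a / ?D\<close> D by (intro mult_strict_left_mono)
    finally show False using True by simp
  qed
  then obtain i where i: "a / ?D \<le> \<bar>real_of_int (z $ i)\<bar>" by blast
  have "1 = exp (- \<theta> * a / ?D) * exp (\<theta> * (a / ?D))"
    by (simp flip: exp_add)
  also have "\<dots> \<le> exp (- \<theta> * a / ?D) * exp \<bar>\<theta> * real_of_int (z $ i)\<bar>"
    using mult_left_mono[OF i assms(2)] assms by (intro mult_left_mono) (auto simp: abs_mult)
  also have "exp \<bar>\<theta> * real_of_int (z $ i)\<bar> \<le> 2 * cosh \<bar>\<theta> * real_of_int (z $ i)\<bar>"
    unfolding cosh_def by simp
  also have "exp (- \<theta> * a / ?D) * (2 * cosh \<bar>\<theta> * real_of_int (z $ i)\<bar>)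
     = 2 * exp (- \<theta> * a / ?D) * cosh (\<theta> * real_of_int (z $ i))"
    by (simp add: cosh_real_abs)
  also have "\<dots> \<le> (\<Sum>i\<in>UNIV. 2 * exp (- \<theta> * a / ?D) * cosh (\<theta> * real_of_int (z $ i)))"
    by (rule member_le_sum) (auto intro: cosh_real_nonneg)
  finally show ?thesis by (simp add: far_ind_def mult_left_mono)
qed (auto simp: far_ind_def intro!: sum_nonneg cosh_real_nonneg)

text \<open>Split the path at time \<open>m\<close>, at position \<open>z\<close>. If \<open>z\<close> is far from \<open>0\<close>, the first part of the path has travelled
  far, and the second part costs its supremum. Otherwise \<open>x - z\<close> is far from \<open>0\<close>: as a function of \<open>z\<close>, the
  probability of the second part then has mass at most the probability that \<open>k\<close> steps travel far, by translation
  invariance, and the first part costs its supremum.\<close>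

lemma walk_op_pow_halving:
  fixes p :: "int ^ 'd \<Rightarrow> real"
  assumes L: "0 < L" and p: "\<And>y. y \<in> lattice_box L \<Longrightarrow> 0 \<le> p y" and x: "x \<in> lattice_box L" and a: "2 * a \<le> lnorm x"
    and k: "\<And>z. (walk_op L p ^^ k) (residue_ind L x) z \<le> Mk"
    and m: "\<And>g \<mu> z. (\<And>z. 0 \<le> g z) \<Longrightarrow> (\<And>z. (\<Sum>y\<in>lattice_box L. g (z + y)) \<le> \<mu>) \<Longrightarrow> 0 \<le> \<mu> \<Longrightarrow>
      (walk_op L p ^^ m) g z \<le> Mm * \<mu>"
  shows "(walk_op L p ^^ (m + k)) (residue_ind L x) 0
    \<le> Mk * (walk_op L p ^^ m) (far_ind L a) 0 + Mm * (walk_op L p ^^ k) (far_ind L a) 0"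
proof -
  let ?T = "walk_op L p"
  define h where "h = (?T ^^ k) (residue_ind L x)"
  define g where "g z = (1 - far_ind L a z) * h z" for z
  define \<mu> where "\<mu> = (?T ^^ k) (far_ind L a) 0"
  have r0: "0 \<le> residue_ind L y z" and f0: "0 \<le> far_ind L a z" and f1: "far_ind L a z \<le> 1" for y z :: "int ^ 'd"
    by (auto simp: residue_ind_def far_ind_def)
  have pos: "0 \<le> (?T ^^ j) v z" if "\<And>z. 0 \<le> v z" for j v z
    using walk_op_pow_mono[of L p p v v] p that by blast
  have mono: "(?T ^^ j) u z \<le> (?T ^^ j) v z" if "\<And>z. 0 \<le> u z" "\<And>z. u z \<le> v z" for j u v z
    using walk_op_pow_mono[of L p p u v] p that by blast
  have h0: "0 \<le> h z" for z unfolding h_def by (intro pos r0)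
  have \<mu>0: "0 \<le> \<mu>" unfolding \<mu>_def by (intro pos f0)
  have g0: "0 \<le> g z" for z using f1 h0 by (simp add: g_def)
  have g_le: "g v \<le> (?T ^^ k) (\<lambda>u. residue_ind L (x - v) u * far_ind L a u) 0" for v
  proof (cases "far_ind L a v = 1")
    case False
    then have "lnorm (lattice_rep L v) < a" by (auto simp: far_ind_def)
    then have far: "a \<le> lnorm (lattice_rep L (x - v))"
      using lnorm_lattice_rep_triangle[OF L x, of v] a by linarith
    have "g v \<le> h v" using f0 h0 by (simp add: g_def mult_left_le_one_le f1)
    also have "h v = (?T ^^ k) (\<lambda>u. residue_ind L x (u + v)) 0"
      by (simp add: h_def walk_op_pow_translate)
    also have "(\<lambda>u. residue_ind L x (u + v)) = (\<lambda>u. residue_ind L (x - v) u * far_ind L a u)"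
    proof
      fix u
      have "residue_ind L x (u + v) = residue_ind L (x - v) u"
        by (simp add: residue_ind_def cong_iff_dvd_diff algebra_simps)
      also have "\<dots> = residue_ind L (x - v) u * far_ind L a u"
        using far by (auto simp: residue_ind_eq[OF L] far_ind_def)
      finally show "residue_ind L x (u + v) = residue_ind L (x - v) u * far_ind L a u" .
    qed
    finally show ?thesis .
  qed (auto simp: g_def intro!: pos mult_nonneg_nonneg r0 f0)
  have g_mass: "(\<Sum>y\<in>lattice_box L. g (z + y)) \<le> \<mu>" for z
  proof -
    have "(\<Sum>y\<in>lattice_box L. g (z + y))
      \<le> (\<Sum>y\<in>lattice_box L. 1 * (?T ^^ k) (\<lambda>u. residue_ind L (x - (z + y)) u * far_ind L a u) 0)"
      using g_le by (intro sum_mono) simp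
    also have "\<dots> = (?T ^^ k) (\<lambda>u. \<Sum>y\<in>lattice_box L. 1 * (residue_ind L (x - (z + y)) u * far_ind L a u)) 0"
      by (rule walk_op_pow_sum[symmetric])
    also have "(\<lambda>u. \<Sum>y\<in>lattice_box L. 1 * (residue_ind L (x - (z + y)) u * far_ind L a u)) = far_ind L a"
    proof
      fix u
      have "residue_ind L (x - (z + y)) u = residue_ind L (x - z) (u + y)" for y
        by (simp add: residue_ind_def cong_iff_dvd_diff algebra_simps)
      then show "(\<Sum>y\<in>lattice_box L. 1 * (residue_ind L (x - (z + y)) u * far_ind L a u)) = far_ind L a u"
        using sum_residue_ind[OF L, of "\<lambda>_. far_ind L a u" "x - z" u] by (simp add: mult.commute)
    qed
    finally show ?thesis by (simp add: \<mu>_def)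
  qed
  have "(?T ^^ (m + k)) (residue_ind L x) 0 = (?T ^^ m) (\<lambda>z. far_ind L a z * h z + g z) 0"
  proof -
    have "(\<lambda>z. far_ind L a z * h z + g z) = h" by (simp add: g_def algebra_simps)
    then show ?thesis by (simp add: funpow_add h_def)
  qed
  also have "\<dots> = (?T ^^ m) (\<lambda>z. far_ind L a z * h z) 0 + (?T ^^ m) g 0"
    by (rule walk_op_pow_add)
  also have "(?T ^^ m) (\<lambda>z. far_ind L a z * h z) 0 \<le> (?T ^^ m) (\<lambda>z. Mk * far_ind L a z) 0"
    using k f0 h0 by (intro mono) (auto simp: h_def mult.commute[of Mk] intro!: mult_left_mono)
  also have "\<dots> = Mk * (?T ^^ m) (far_ind L a) 0" by (rule walk_op_pow_cmult)
  also have "(?T ^^ m) g 0 \<le> Mm * \<mu>" by (intro m g0 g_mass \<mu>0)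
  finally show ?thesis by (simp add: \<mu>_def)
qed

context stable_kernel
begin

lemma W_pos: "0 < W" and L_pos: "0 < L"
  using W_ge_1 L_ge by (auto intro: gr0I)

lemma truncate_nonneg: "y \<in> lattice_box L \<Longrightarrow> 0 \<le> truncate_kernel \<rho> q y"
  and truncate_le: "y \<in> lattice_box L \<Longrightarrow> truncate_kernel \<rho> q y \<le> q y"
  using nonneg by (auto simp: truncate_kernel_def)

lemma sum_truncate_le: "sum (truncate_kernel \<rho> q) (lattice_box L) \<le> 1"
  unfolding total[symmetric] by (intro sum_mono truncate_le)

text \<open>Decompose according to which of the \<open>n\<close> steps is the first long jump. Such a jump averages a function of mass at
  most \<open>\<mu>\<close> with weights at most the largest value of \<open>q\<close> beyond distance \<open>\<rho>\<close>.\<close>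

lemma one_big_jump:
  assumes "0 < \<rho>" "\<And>z. 0 \<le> g z" "\<And>z. (\<Sum>y\<in>lattice_box L. g (z + y)) \<le> \<mu>" "0 \<le> \<mu>"
  shows "(walk_op L q ^^ n) g z \<le> (walk_op L (truncate_kernel \<rho> q) ^^ n) g z
    + real n * (C * W powr \<alpha> * \<rho> powr (- real CARD('d) - \<alpha>) * \<mu>)"
proof (induction n arbitrary: z)
  case (Suc n)
  let ?p = "truncate_kernel \<rho> q" and ?r = "\<lambda>y. q y - truncate_kernel \<rho> q y"
  let ?\<beta> = "C * W powr \<alpha> * \<rho> powr (- real CARD('d) - \<alpha>)"
  let ?g = "(walk_op L q ^^ n) g"
  have g0: "0 \<le> ?g z" for z
    using walk_op_pow_mono[of L q q g g] assms(2) nonneg by blast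
  have b0: "0 \<le> ?\<beta>" using constants by simp
  have big: "?r y \<le> ?\<beta>" if y: "y \<in> lattice_box L" for y
  proof (cases "lnorm y \<le> \<rho>")
    case False
    have "y \<noteq> 0"
    proof
      assume "y = 0"
      then show False using False assms(1) by simp
    qed
    then have "q y \<le> C * W powr \<alpha> * lnorm y powr (- real CARD('d) - \<alpha>)" by (rule decay[OF y])
    also have "\<dots> \<le> ?\<beta>"
      using False assms(1) constants alpha by (intro mult_left_mono powr_mono2') auto
    finally show ?thesis using False by (simp add: truncate_kernel_def)
  qed (use b0 in \<open>simp add: truncate_kernel_def\<close>)
  define P where "P = (walk_op L ?p ^^ Suc n) g z"
  define b where "b = ?\<beta> * \<mu>"
  have "(walk_op L q ^^ Suc n) g z = walk_op L q ?g z" by simp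
  moreover have "walk_op L q ?g z = walk_op L ?p ?g z + walk_op L ?r ?g z"
    unfolding walk_op_def[of L _ ?g] sum.distrib[symmetric] by (intro sum.cong) (auto simp: left_diff_distrib)
  moreover have "walk_op L ?p ?g z \<le> (\<Sum>y\<in>lattice_box L. ?p y * ((walk_op L ?p ^^ n) g (z + y) + real n * b))"
    unfolding walk_op_def[of L ?p ?g] b_def by (intro sum_mono mult_left_mono truncate_nonneg Suc.IH)
  moreover have "(\<Sum>y\<in>lattice_box L. ?p y * ((walk_op L ?p ^^ n) g (z + y) + real n * b))
      = P + sum ?p (lattice_box L) * (real n * b)"
    unfolding P_def by (simp add: walk_op_def[of L ?p "(_ ^^ _) _"] distrib_left sum.distrib sum_distrib_right)
  moreover have "sum ?p (lattice_box L) * (real n * b) \<le> 1 * (real n * b)"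
    unfolding b_def by (intro mult_right_mono sum_truncate_le mult_nonneg_nonneg[OF of_nat_0_le_iff] mult_nonneg_nonneg[OF b0 assms(4)])
  moreover have "walk_op L ?r ?g z \<le> b"
    unfolding b_def
  proof (rule walk_op_le_sup_times_mass[OF big b0 g0])
    show "(\<Sum>y\<in>lattice_box L. ?g (z + y)) \<le> \<mu>"
      by (rule walk_op_pow_mass[OF nonneg eq_refl[OF total] assms(3,4)])
  qed
  ultimately have "(walk_op L q ^^ Suc n) g z \<le> P + real (Suc n) * b"
    by (simp only: of_nat_Suc distrib_right)
  then show ?case by (simp only: P_def b_def)
qed simp

lemma truncate_second_moment:
  assumes T: "\<And>(A :: (int ^ 'd) set) R. 0 < R \<Longrightarrow> (\<forall>x\<in>A. x \<noteq> 0 \<and> lnorm x \<le> R) \<Longrightarrow>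
    (\<Sum>x\<in>A. (lnorm x)\<^sup>2 * lnorm x powr (- real CARD('d) - \<alpha>)) \<le> T * R powr (2 - \<alpha>)"
    and "0 < \<rho>"
  shows "(\<Sum>y\<in>lattice_box L. truncate_kernel \<rho> q y * (lnorm y)\<^sup>2) \<le> C * W powr \<alpha> * (T * \<rho> powr (2 - \<alpha>))"
proof -
  define A where "A = {y :: int ^ 'd. y \<in> lattice_box L \<and> y \<noteq> 0 \<and> lnorm y \<le> \<rho>}"
  have "(\<Sum>y\<in>lattice_box L. truncate_kernel \<rho> q y * (lnorm y)\<^sup>2) = (\<Sum>y\<in>A. q y * (lnorm y)\<^sup>2)"
    by (rule sum.mono_neutral_cong_right) (auto simp: A_def truncate_kernel_def finite_lattice_box)
  also have "\<dots> \<le> (\<Sum>y\<in>A. C * W powr \<alpha> * ((lnorm y)\<^sup>2 * lnorm y powr (- real CARD('d) - \<alpha>)))"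
  proof (rule sum_mono)
    fix y assume "y \<in> A"
    then have "q y * (lnorm y)\<^sup>2 \<le> C * W powr \<alpha> * lnorm y powr (- real CARD('d) - \<alpha>) * (lnorm y)\<^sup>2"
      by (intro mult_right_mono decay) (auto simp: A_def)
    then show "q y * (lnorm y)\<^sup>2 \<le> C * W powr \<alpha> * ((lnorm y)\<^sup>2 * lnorm y powr (- real CARD('d) - \<alpha>))"
      by (simp add: mult_ac)
  qed
  also have "\<dots> \<le> C * W powr \<alpha> * (T * \<rho> powr (2 - \<alpha>))"
    unfolding sum_distrib_left[symmetric] using constants assms
    by (intro mult_left_mono) (auto simp: A_def)
  finally show ?thesis .
qed

text \<open>By the addition theorem the operator maps \<open>cosh (\<theta> z\<^sub>i)\<close> to a combination of \<open>cosh (\<theta> z\<^sub>i)\<close> and \<open>sinh (\<theta> z\<^sub>i)\<close>,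
  and the coefficient of the latter is an odd moment of the kernel. It vanishes because \<open>\<rho> < L/2\<close> keeps the truncated
  kernel away from the asymmetric faces of the box.\<close>

lemma truncate_cosh_eigen:
  fixes i :: 'd
  assumes "\<rho> < real L / 2"
  shows "walk_op L (truncate_kernel \<rho> q) (\<lambda>z. cosh (\<theta> * real_of_int (z $ i))) z
    = (\<Sum>y\<in>lattice_box L. truncate_kernel \<rho> q y * cosh (\<theta> * real_of_int (y $ i))) * cosh (\<theta> * real_of_int (z $ i))"
proof -
  let ?p = "truncate_kernel \<rho> q"
  define A where "A = {y :: int ^ 'd. lnorm y \<le> \<rho>}"
  have A: "A \<subseteq> lattice_box L"
  proof
    fix y assume "y \<in> A"
    then have "\<bar>real_of_int (y $ i)\<bar> < real L / 2" for i
      using component_le_lnorm[of y i] assms by (simp add: A_def)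
    then show "y \<in> lattice_box L" by (rule in_lattice_boxI)
  qed
  have neg: "y \<in> A \<Longrightarrow> - y \<in> A" for y by (simp add: A_def lattice_vec_uminus)
  have p: "?p (- y) = ?p y" if "y \<in> A" for y
    using neg[OF that] that A even[of y] by (auto simp: truncate_kernel_def lattice_vec_uminus)
  have "(\<Sum>y\<in>A. ?p y * sinh (\<theta> * real_of_int (y $ i))) = (\<Sum>y\<in>A. ?p (- y) * sinh (\<theta> * real_of_int ((- y) $ i)))"
    by (rule sum.reindex_bij_witness[of _ uminus uminus]) (auto simp: neg)
  also have "\<dots> = - (\<Sum>y\<in>A. ?p y * sinh (\<theta> * real_of_int (y $ i)))"
    by (simp add: p sinh_minus flip: sum_negf)
  finally have "(\<Sum>y\<in>A. ?p y * sinh (\<theta> * real_of_int (y $ i))) = 0" by simp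
  also have "(\<Sum>y\<in>A. ?p y * sinh (\<theta> * real_of_int (y $ i))) = (\<Sum>y\<in>lattice_box L. ?p y * sinh (\<theta> * real_of_int (y $ i)))"
    using A by (intro sum.mono_neutral_left) (auto simp: A_def truncate_kernel_def finite_lattice_box)
  finally have odd: "(\<Sum>y\<in>lattice_box L. ?p y * sinh (\<theta> * real_of_int (y $ i))) = 0" .
  have "walk_op L ?p (\<lambda>z. cosh (\<theta> * real_of_int (z $ i))) z =
    (\<Sum>y\<in>lattice_box L. ?p y * cosh (\<theta> * real_of_int (y $ i))) * cosh (\<theta> * real_of_int (z $ i)) +
    (\<Sum>y\<in>lattice_box L. ?p y * sinh (\<theta> * real_of_int (y $ i))) * sinh (\<theta> * real_of_int (z $ i))"
    unfolding walk_op_def sum_distrib_right sum.distrib[symmetric]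
    by (intro sum.cong) (auto simp: cosh_add algebra_simps)
  then show ?thesis by (simp add: odd)
qed

text \<open>The exponential Chebyshev inequality. The eigenvalue of \<open>cosh (\<theta> z\<^sub>i)\<close> is at most
  \<open>1 + \<theta>\<^sup>2 exp (\<theta> \<rho>)\<close> times the second moment of the truncated kernel, and that second moment is of order
  \<open>W\<^sup>\<alpha> \<rho>\<^bsup>2-\<alpha>\<^esup>\<close>.\<close>

lemma truncate_tail:
  assumes T: "\<And>(A :: (int ^ 'd) set) R. 0 < R \<Longrightarrow> (\<forall>x\<in>A. x \<noteq> 0 \<and> lnorm x \<le> R) \<Longrightarrow>
    (\<Sum>x\<in>A. (lnorm x)\<^sup>2 * lnorm x powr (- real CARD('d) - \<alpha>)) \<le> T * R powr (2 - \<alpha>)"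
    and "0 < \<rho>" "\<rho> < real L / 2" "0 \<le> \<theta>" "0 \<le> a"
  shows "(walk_op L (truncate_kernel \<rho> q) ^^ n) (far_ind L a) 0
    \<le> 2 * real CARD('d) * exp (- \<theta> * a / sqrt (real CARD('d)))
        * exp (real n * (C * T * (W / \<rho>) powr \<alpha> * ((\<theta> * \<rho>)\<^sup>2 * exp (\<theta> * \<rho>))))"
proof -
  let ?p = "truncate_kernel \<rho> q"
  define M where "M i = (\<Sum>y\<in>lattice_box L. ?p y * cosh (\<theta> * real_of_int (y $ i)))" for i
  define V where "V = C * T * (W / \<rho>) powr \<alpha> * ((\<theta> * \<rho>)\<^sup>2 * exp (\<theta> * \<rho>))"
  let ?e = "2 * exp (- \<theta> * a / sqrt (real CARD('d)))"
  have M0: "0 \<le> M i" for i unfolding M_def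
    by (intro sum_nonneg mult_nonneg_nonneg truncate_nonneg cosh_real_nonneg)
  have M: "M i \<le> exp V" for i
  proof -
    have "M i \<le> (\<Sum>y\<in>lattice_box L. ?p y * (1 + (\<theta>\<^sup>2 * exp (\<theta> * \<rho>)) * (lnorm y)\<^sup>2))"
      unfolding M_def
    proof (rule sum_mono)
      fix y :: "int ^ 'd" assume y: "y \<in> lattice_box L"
      show "?p y * cosh (\<theta> * real_of_int (y $ i)) \<le> ?p y * (1 + (\<theta>\<^sup>2 * exp (\<theta> * \<rho>)) * (lnorm y)\<^sup>2)"
      proof (cases "lnorm y \<le> \<rho>")
        case True
        have yi: "\<bar>real_of_int (y $ i)\<bar> \<le> lnorm y" by (rule component_le_lnorm)
        have "cosh (\<theta> * real_of_int (y $ i)) \<le> 1 + (\<theta> * real_of_int (y $ i))\<^sup>2 * exp \<bar>\<theta> * real_of_int (y $ i)\<bar>"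
          by (rule cosh_le_one_plus)
        also have "\<dots> \<le> 1 + (\<theta>\<^sup>2 * (lnorm y)\<^sup>2) * exp (\<theta> * \<rho>)"
        proof (intro add_left_mono mult_mono)
          show "(\<theta> * real_of_int (y $ i))\<^sup>2 \<le> \<theta>\<^sup>2 * (lnorm y)\<^sup>2"
            using yi by (auto simp: power_mult_distrib abs_le_square_iff[symmetric] intro!: mult_left_mono)
          show "exp \<bar>\<theta> * real_of_int (y $ i)\<bar> \<le> exp (\<theta> * \<rho>)"
            using yi True assms by (auto simp: abs_mult intro!: mult_left_mono)
        qed auto
        finally show ?thesis
          by (intro mult_left_mono truncate_nonneg y) (simp add: mult_ac)
      qed (simp add: truncate_kernel_def)
    qed
    also have "\<dots> = sum ?p (lattice_box L) + (\<theta>\<^sup>2 * exp (\<theta> * \<rho>)) * (\<Sum>y\<in>lattice_box L. ?p y * (lnorm y)\<^sup>2)"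
      by (simp add: distrib_left sum.distrib sum_distrib_left mult_ac)
    also have "\<dots> \<le> 1 + (\<theta>\<^sup>2 * exp (\<theta> * \<rho>)) * (C * W powr \<alpha> * (T * \<rho> powr (2 - \<alpha>)))"
      using truncate_second_moment[OF T assms(2)] by (intro add_mono sum_truncate_le mult_left_mono) auto
    also have "\<dots> = 1 + V"
      using assms(2) W_pos
      by (simp add: V_def powr_diff powr_divide powr_numeral power_mult_distrib field_simps)
    also have "\<dots> \<le> exp V" by (rule exp_ge_add_one_self)
    finally show ?thesis .
  qed
  have f0: "0 \<le> far_ind L a z" for z :: "int ^ 'd" by (simp add: far_ind_def)
  have "(walk_op L ?p ^^ n) (far_ind L a) 0
    \<le> (walk_op L ?p ^^ n) (\<lambda>z. \<Sum>i\<in>UNIV. ?e * cosh (\<theta> * real_of_int (z $ i))) 0"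
    using walk_op_pow_mono[OF conjI[OF truncate_nonneg order_refl] conjI[OF f0 far_ind_le_cosh[OF L_pos assms(4,5)]]]
    by (rule conjunct2)
  also have "\<dots> = (\<Sum>i\<in>UNIV. ?e * (walk_op L ?p ^^ n) (\<lambda>z. cosh (\<theta> * real_of_int (z $ i))) 0)"
    by (rule walk_op_pow_sum)
  also have "\<dots> = (\<Sum>i\<in>UNIV. ?e * (M i) ^ n)"
    using walk_op_pow_eigen[OF truncate_cosh_eigen[OF assms(3)]] by (simp add: M_def)
  also have "\<dots> \<le> (\<Sum>i\<in>(UNIV :: 'd set). ?e * (exp V) ^ n)"
    using M M0 by (intro sum_mono mult_left_mono power_mono) auto
  also have "\<dots> = 2 * real CARD('d) * exp (- \<theta> * a / sqrt (real CARD('d))) * exp (real n * V)"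
    by (simp flip: exp_of_nat_mult)
  finally show ?thesis unfolding V_def .
qed

end

section \<open>The heat kernel bound\<close>

text \<open>For \<open>n \<ge> 2\<close>, both halves of an \<open>n\<close>-step path have length at least \<open>n/3\<close>, so their on-diagonal bounds are as good as the one for
  \<open>n\<close> steps.\<close>

lemma spread_bound_mono:
  assumes "0 < \<alpha>" "1 \<le> j" "1 \<le> n" "n \<le> 3 * j" "0 < W"
  shows "spread_bound d \<alpha> L W j \<le> 3 powr (real d / \<alpha>) * spread_bound d \<alpha> L W n"
proof -
  let ?s = "real d / \<alpha>"
  have s: "0 \<le> ?s" using assms by simp
  have "real n powr ?s \<le> (3 * real j) powr ?s"
    using assms s by (intro powr_mono2) auto
  also have "\<dots> = 3 powr ?s * real j powr ?s" by (simp add: powr_mult)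
  finally have "1 / real j powr ?s \<le> 3 powr ?s / real n powr ?s"
    using assms by (simp add: field_simps)
  then have "1 / real j powr ?s / W ^ d \<le> 3 powr ?s / real n powr ?s / W ^ d"
    using assms by (intro divide_right_mono) auto
  moreover have "1 * (1 / real L ^ d) \<le> 3 powr ?s * (1 / real L ^ d)"
    using s by (intro mult_right_mono ge_one_powr_ge_zero) auto
  ultimately show ?thesis by (simp add: spread_bound_def distrib_left)
qed

text \<open>Combines the three ingredients in the regime \<open>n W\<^sup>\<alpha> \<le> \<bar>x\<bar>\<^sup>\<alpha>\<close>: one long jump, or else a journey of length \<open>r/2\<close> with
  short jumps in one half of the time and an on-diagonal factor from the other half. Halving needs two nonempty halves,
  so \<open>n = 1\<close> is treated by the decay of the kernel itself.\<close>

lemma off_diagonal_bound: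
  assumes "0 < \<alpha>" "\<alpha> < 2" "0 < c" "0 < C"
  shows "\<exists>A>0. \<forall>L W (q :: int ^ 'd \<Rightarrow> real) n x. stable_kernel \<alpha> c C L W q \<longrightarrow> 1 \<le> n \<longrightarrow>
    x \<in> lattice_box L \<longrightarrow> real n * W powr \<alpha> \<le> lnorm x powr \<alpha> \<longrightarrow>
    (walk_op L q ^^ n) (residue_ind L x) 0
      \<le> A * (real n * W powr \<alpha> / lnorm x powr (real CARD('d) + \<alpha>) + 1 / real L ^ CARD('d))"
proof -
  let ?d = "CARD('d)" and ?D = "sqrt (real CARD('d))"
  obtain A where A: "0 < A" and on_diagonal: "\<And>L W (q :: int ^ 'd \<Rightarrow> real) g \<mu> n z.
      stable_kernel \<alpha> c C L W q \<Longrightarrow> 1 \<le> n \<Longrightarrow> 0 \<le> \<mu> \<Longrightarrow> (\<And>z. 0 \<le> g z) \<Longrightarrow>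
      (\<And>z. (\<Sum>y\<in>lattice_box L. g (z + y)) \<le> \<mu>) \<Longrightarrow>
      (walk_op L q ^^ n) g z \<le> A * \<mu> * spread_bound ?d \<alpha> L W n"
    using on_diagonal_bound[OF assms(1,3,4), where 'd = 'd] by blast
  obtain T where T: "0 < T" and second_moment: "\<And>(B :: (int ^ 'd) set) R. 0 < R \<Longrightarrow>
      (\<forall>x\<in>B. x \<noteq> 0 \<and> lnorm x \<le> R) \<Longrightarrow>
      (\<Sum>x\<in>B. (lnorm x)\<^sup>2 * lnorm x powr (- real ?d - \<alpha>)) \<le> T * R powr (2 - \<alpha>)"
    using second_moment_sum_le[OF assms(1,2), where 'd = 'd] by blast
  define s where "s = real ?d / \<alpha>"
  \<comment> \<open>with jumps up to \<open>r / K\<close>, this \<open>K\<close> turns the exponential gain into exactly \<open>t\<^bsup>1 + s\<^esup>\<close>; it also exceeds \<open>sqrt d\<close>, so that \<open>r / K < L / 2\<close>\<close>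
  define K where "K = 4 * ?D * (1 + s)"
  define E where "E = 2 * real ?d * exp (2 * C * T * K powr \<alpha>)"
  define F where "F = 2 * (A * 3 powr s) * E + C * K powr (real ?d + \<alpha>) + C"
  have s: "0 < s" using assms by (simp add: s_def)
  have D: "1 \<le> ?D" by simp
  have K: "?D < K" using s D unfolding K_def by (simp add: algebra_simps add_pos_pos)
  then have K0: "0 < K" using D by linarith
  have E: "0 < E" by (simp add: E_def)
  have F: "0 < F" using A E assms K0 by (auto simp: F_def intro!: add_pos_pos)
  have "(walk_op L q ^^ n) (residue_ind L x) 0
      \<le> F * (real n * W powr \<alpha> / lnorm x powr (real ?d + \<alpha>) + 1 / real L ^ ?d)"
    if K': "stable_kernel \<alpha> c C L W q" and n: "1 \<le> n" and x: "x \<in> lattice_box L"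
      and far: "real n * W powr \<alpha> \<le> lnorm x powr \<alpha>"
    for L W n x and q :: "int ^ 'd \<Rightarrow> real"
  proof -
    interpret stable_kernel \<alpha> c C L W q by (fact K')
    define r where "r = lnorm x"
    define t where "t = real n * W powr \<alpha> / r powr \<alpha>"
    define G where "G = real n * W powr \<alpha> / r powr (real ?d + \<alpha>)"
    define Y where "Y = 1 / real L ^ ?d"
    have n0: "0 < real n" using n by simp
    have "0 < real n * W powr \<alpha>" using n0 W_pos by simp
    then have "0 < r powr \<alpha>" using far unfolding r_def by linarith
    then have r: "0 < r" by (simp add: r_def)
    then have x0: "x \<noteq> 0" by (auto simp: r_def)
    have t: "0 < t" "t \<le> 1"
      using far r W_pos n0 by (auto simp: t_def r_def)
    have G: "G = t / r powr ?d" by (simp add: G_def t_def powr_add mult.commute)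
    have G0: "0 \<le> G" and Y0: "0 \<le> Y" by (auto simp: G_def Y_def)
    show ?thesis unfolding r_def[symmetric] G_def[symmetric] Y_def[symmetric]
    proof (cases "n = 1")
      case True
      have "(walk_op L q ^^ n) (residue_ind L x) 0 = q x"
        using sum_residue_ind[OF L_pos, of q x 0] by (simp add: True walk_op_def lattice_rep_of_box L_pos x)
      also have "\<dots> \<le> C * W powr \<alpha> * r powr (- real ?d - \<alpha>)"
        unfolding r_def by (rule decay[OF x x0])
      also have "- real ?d - \<alpha> = - (real ?d + \<alpha>)" by simp
      also have "C * W powr \<alpha> * r powr (- (real ?d + \<alpha>)) = C * G"
        unfolding powr_minus by (simp add: G_def True divide_inverse)
      also have "\<dots> \<le> F * (G + Y)"
        using F G0 Y0 A E constants K0 by (intro mult_mono) (auto simp: F_def)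
      finally show "(walk_op L q ^^ n) (residue_ind L x) 0 \<le> F * (G + Y)" .
    next
      case False
      define m where "m = n div 2"
      define k where "k = n - m"
      define \<rho> where "\<rho> = r / K"
      \<comment> \<open>the tilt: \<open>exp (2 v) = 1/t\<close> just compensates the factor \<open>t\<close> in the exponential moment below\<close>
      define v where "v = ln (1 / t) / 2"
      define \<theta> where "\<theta> = v / \<rho>"
      define p where "p = truncate_kernel \<rho> q"
      have mk: "n = m + k" "1 \<le> m" "1 \<le> k" "n \<le> 3 * m" "n \<le> 3 * k"
        using n False unfolding m_def k_def by linarith+
      have \<rho>: "0 < \<rho>" using r K0 by (simp add: \<rho>_def)
      have "\<bar>real_of_int (x $ i)\<bar> \<le> real L / 2" for i
      proof -
        have "- (real L / 2) < real_of_int (x $ i)" "real_of_int (x $ i) \<le> real L / 2"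
          using x by (auto simp: lattice_box_def)
        then show ?thesis by linarith
      qed
      then have "r \<le> ?D * (real L / 2)"
        unfolding r_def by (rule lnorm_le_sqrt) simp
      also have "\<dots> < K * (real L / 2)"
        using K L_pos by (intro mult_strict_right_mono) auto
      finally have \<rho>L: "\<rho> < real L / 2" using K0 by (simp add: \<rho>_def field_simps)
      have v: "0 \<le> v" using t by (simp add: v_def)
      have \<theta>: "0 \<le> \<theta>" using v \<rho> by (simp add: \<theta>_def)
      have \<theta>\<rho>: "\<theta> * \<rho> = v" using \<rho> by (simp add: \<theta>_def)
      have p0: "0 \<le> p y" and pq: "p y \<le> q y" if "y \<in> lattice_box L" for y
        using truncate_nonneg truncate_le that by (auto simp: p_def)
      have tail: "(walk_op L p ^^ j) (far_ind L (r / 2)) 0 \<le> E * t powr (1 + s)" if j: "j \<le> n" for j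
      proof -
        have "v\<^sup>2 / 2 \<le> exp v"
          using exp_lower_Taylor_quadratic[OF v] v by linarith
        then have "v\<^sup>2 * exp v \<le> (2 * exp v) * exp v"
          by (intro mult_right_mono) auto
        moreover have "exp v * exp v = 1 / t"
          using t by (simp add: v_def flip: exp_add)
        ultimately have "v\<^sup>2 * exp v \<le> 2 / t" by (simp add: mult.assoc)
        then have "C * T * (W / \<rho>) powr \<alpha> * (v\<^sup>2 * exp v) \<le> C * T * (W / \<rho>) powr \<alpha> * (2 / t)"
          using constants T by (intro mult_left_mono) auto
        moreover have "(W / \<rho>) powr \<alpha> = K powr \<alpha> * (t / n)"
          using W_pos r K0 n0 by (simp add: \<rho>_def t_def powr_mult powr_divide)
        then have "C * T * (W / \<rho>) powr \<alpha> * (2 / t) = 2 * C * T * K powr \<alpha> / n"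
          using t by simp
        ultimately have "C * T * (W / \<rho>) powr \<alpha> * (v\<^sup>2 * exp v) \<le> 2 * C * T * K powr \<alpha> / n"
          by linarith
        then have "real j * (C * T * (W / \<rho>) powr \<alpha> * (v\<^sup>2 * exp v)) \<le> real n * (2 * C * T * K powr \<alpha> / n)"
          using j constants T by (intro mult_mono) auto
        then have exponent: "real j * (C * T * (W / \<rho>) powr \<alpha> * (v\<^sup>2 * exp v)) \<le> 2 * C * T * K powr \<alpha>"
          using n0 by simp
        have "\<theta> * (r / 2) / ?D = v * (K / (2 * ?D))"
          using K0 r by (simp add: \<theta>_def \<rho>_def)
        moreover have "K / (2 * ?D) = 2 * (1 + s)" by (simp add: K_def)
        ultimately have "- \<theta> * (r / 2) / ?D = (1 + s) * ln t"
          using t by (simp add: v_def ln_div)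
        then have tilt: "exp (- \<theta> * (r / 2) / ?D) = t powr (1 + s)"
          using t by (simp add: powr_def)
        have "(walk_op L p ^^ j) (far_ind L (r / 2)) 0 \<le> 2 * real ?d * exp (- \<theta> * (r / 2) / ?D)
          * exp (real j * (C * T * (W / \<rho>) powr \<alpha> * (v\<^sup>2 * exp v)))"
          unfolding p_def \<theta>\<rho>[symmetric]
          by (rule truncate_tail[OF second_moment \<rho> \<rho>L \<theta>]) (use r in auto)
        also have "\<dots> \<le> 2 * real ?d * t powr (1 + s) * exp (2 * C * T * K powr \<alpha>)"
          unfolding tilt using exponent by (intro mult_left_mono) auto
        finally show ?thesis by (simp add: E_def mult_ac)
      qed
      define S where "S = spread_bound ?d \<alpha> L W n"
      have S0: "0 \<le> S" using W_pos by (simp add: S_def spread_bound_def)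
      have sup: "(walk_op L p ^^ j) g z \<le> A * 3 powr s * S * \<mu>"
        if j: "1 \<le> j" "n \<le> 3 * j" and g: "\<And>z. 0 \<le> g z"
          and mass: "\<And>z. (\<Sum>y\<in>lattice_box L. g (z + y)) \<le> \<mu>" and \<mu>: "0 \<le> \<mu>" for j g \<mu> z
      proof -
        have "(walk_op L p ^^ j) g z \<le> (walk_op L q ^^ j) g z"
          using walk_op_pow_mono[of L p q g g] p0 pq g by blast
        also have "\<dots> \<le> A * \<mu> * spread_bound ?d \<alpha> L W j"
          by (rule on_diagonal[OF K' j(1) \<mu> g mass])
        also have "\<dots> \<le> A * \<mu> * (3 powr s * S)"
          unfolding S_def s_def using A \<mu> by (intro mult_left_mono spread_bound_mono alpha j n W_pos) auto
        finally show ?thesis by (simp add: mult_ac)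
      qed
      have r0: "0 \<le> residue_ind L x z" for z :: "int ^ 'd" by (simp add: residue_ind_def)
      have r1: "(\<Sum>y\<in>lattice_box L. residue_ind L x (z + y)) \<le> 1" for z :: "int ^ 'd"
        using sum_residue_ind[OF L_pos, of "\<lambda>_. 1" x z] by simp
      have "(walk_op L p ^^ (m + k)) (residue_ind L x) 0
        \<le> (A * 3 powr s * S) * (walk_op L p ^^ m) (far_ind L (r / 2)) 0
          + (A * 3 powr s * S) * (walk_op L p ^^ k) (far_ind L (r / 2)) 0"
      proof (rule walk_op_pow_halving[OF L_pos p0 x])
        show "2 * (r / 2) \<le> lnorm x" by (simp add: r_def)
        show "(walk_op L p ^^ k) (residue_ind L x) z \<le> A * 3 powr s * S" for z
          using sup[OF mk(3,5) r0 r1] by simp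
        show "(walk_op L p ^^ m) g z \<le> A * 3 powr s * S * \<mu>"
          if "\<And>z. 0 \<le> g z" "\<And>z. (\<Sum>y\<in>lattice_box L. g (z + y)) \<le> \<mu>" "0 \<le> \<mu>" for g \<mu> z
          by (rule sup[OF mk(2,4) that])
      qed
      also have "\<dots> \<le> (A * 3 powr s * S) * (E * t powr (1 + s)) + (A * 3 powr s * S) * (E * t powr (1 + s))"
        using A S0 mk by (intro add_mono mult_left_mono tail) auto
      also have "\<dots> = 2 * (A * 3 powr s) * E * (S * t powr (1 + s))" by simp
      also have "\<dots> \<le> 2 * (A * 3 powr s) * E * (G + Y)"
      proof (intro mult_left_mono)
        \<comment> \<open>because \<open>\<alpha> s = d\<close>\<close>
        have "t powr s = real n powr s * W ^ ?d / r ^ ?d"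
          using W_pos r n0 alpha by (simp add: t_def s_def powr_divide powr_mult powr_powr powr_realpow)
        then have "1 / (real n powr s * W ^ ?d) * t powr s = 1 / r ^ ?d"
          using n0 W_pos by simp
        then have "1 / (real n powr s * W ^ ?d) * t powr (1 + s) = G"
          using t r by (simp add: G powr_add powr_realpow field_simps)
        moreover have "Y * t powr (1 + s) \<le> Y * 1"
          using t s Y0 by (intro mult_left_mono powr_le1) auto
        ultimately show "S * t powr (1 + s) \<le> G + Y"
          by (simp add: S_def spread_bound_def s_def[symmetric] Y_def[symmetric] distrib_right)
      qed (use A E in auto)
      finally have small: "(walk_op L p ^^ n) (residue_ind L x) 0 \<le> 2 * (A * 3 powr s) * E * (G + Y)"
        using mk by simp
      have "(walk_op L q ^^ n) (residue_ind L x) 0 \<le> (walk_op L p ^^ n) (residue_ind L x) 0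
        + real n * (C * W powr \<alpha> * \<rho> powr (- real ?d - \<alpha>) * 1)"
        unfolding p_def by (rule one_big_jump[OF \<rho> r0 r1]) simp
      also have "real n * (C * W powr \<alpha> * \<rho> powr (- real ?d - \<alpha>) * 1) = C * K powr (real ?d + \<alpha>) * G"
        using r K0 by (simp add: \<rho>_def G_def powr_divide powr_diff powr_minus powr_add field_simps)
      also have "\<dots> \<le> (C * K powr (real ?d + \<alpha>) + C) * (G + Y)"
        using constants G0 Y0 by (intro mult_mono) auto
      finally show "(walk_op L q ^^ n) (residue_ind L x) 0 \<le> F * (G + Y)"
        using small by (simp add: F_def algebra_simps)
    qed
  qed
  with F show ?thesis by blast
qed

text \<open>If \<open>\<bar>x\<bar>\<^sup>\<alpha> < n W\<^sup>\<alpha>\<close>, the first term attains the minimum and the on-diagonal bound is the claim. Otherwise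
  \<open>\<bar>x\<bar> \<ge> W\<close>, and both bounds are available.\<close>

lemma heat_kernel_bound:
  assumes "0 < \<alpha>" "\<alpha> < 2" "0 < c" "0 < C"
  shows "\<exists>A>0. \<forall>L W (q :: int ^ 'd \<Rightarrow> real) n x. stable_kernel \<alpha> c C L W q \<longrightarrow> 1 \<le> n \<longrightarrow>
    x \<in> lattice_box L \<longrightarrow>
    (walk_op L q ^^ n) (residue_ind L x) 0
      \<le> A * (min (1 / (real n powr (real CARD('d) / \<alpha>) * W ^ CARD('d)))
                  (real n * W powr \<alpha> / (max (lnorm x) W) powr (real CARD('d) + \<alpha>)) + 1 / real L ^ CARD('d))"
proof -
  let ?d = "CARD('d)"
  obtain A where A: "0 < A" and on_diagonal: "\<And>L W (q :: int ^ 'd \<Rightarrow> real) g \<mu> n z.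
      stable_kernel \<alpha> c C L W q \<Longrightarrow> 1 \<le> n \<Longrightarrow> 0 \<le> \<mu> \<Longrightarrow> (\<And>z. 0 \<le> g z) \<Longrightarrow>
      (\<And>z. (\<Sum>y\<in>lattice_box L. g (z + y)) \<le> \<mu>) \<Longrightarrow>
      (walk_op L q ^^ n) g z \<le> A * \<mu> * spread_bound ?d \<alpha> L W n"
    using on_diagonal_bound[OF assms(1,3,4), where 'd = 'd] by blast
  obtain B where B: "0 < B" and off_diagonal: "\<And>L W (q :: int ^ 'd \<Rightarrow> real) n x.
      stable_kernel \<alpha> c C L W q \<Longrightarrow> 1 \<le> n \<Longrightarrow> x \<in> lattice_box L \<Longrightarrow>
      real n * W powr \<alpha> \<le> lnorm x powr \<alpha> \<Longrightarrow> (walk_op L q ^^ n) (residue_ind L x) 0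
      \<le> B * (real n * W powr \<alpha> / lnorm x powr (real ?d + \<alpha>) + 1 / real L ^ ?d)"
    using off_diagonal_bound[OF assms, where 'd = 'd] by blast
  have "(walk_op L q ^^ n) (residue_ind L x) 0 \<le> (A + B) *
      (min (1 / (real n powr (real ?d / \<alpha>) * W ^ ?d))
           (real n * W powr \<alpha> / (max (lnorm x) W) powr (real ?d + \<alpha>)) + 1 / real L ^ ?d)"
    if K: "stable_kernel \<alpha> c C L W q" and n: "1 \<le> n" and x: "x \<in> lattice_box L"
    for L W n x and q :: "int ^ 'd \<Rightarrow> real"
  proof -
    interpret stable_kernel \<alpha> c C L W q by (fact K)
    define X where "X = 1 / (real n powr (real ?d / \<alpha>) * W ^ ?d)"
    define Z where "Z = real n * W powr \<alpha> / (max (lnorm x) W) powr (real ?d + \<alpha>)"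
    define Y where "Y = 1 / real L ^ ?d"
    define P where "P = (walk_op L q ^^ n) (residue_ind L x) 0"
    have 0: "0 \<le> X" "0 \<le> Y" "0 \<le> Z" using W_pos by (auto simp: X_def Y_def Z_def)
    have n0: "0 < real n" using n by simp
    have "(\<Sum>y\<in>lattice_box L. residue_ind L x (z + y)) \<le> 1" for z :: "int ^ 'd"
      using sum_residue_ind[OF L_pos, of "\<lambda>_. 1" x z] by simp
    then have on: "P \<le> A * (X + Y)"
      using on_diagonal[OF K n, of 1 "residue_ind L x" 0]
      by (simp add: residue_ind_def P_def X_def Y_def spread_bound_def)
    have "P \<le> (A + B) * (X + Y) \<and> P \<le> (A + B) * (Z + Y)"
    proof (cases "real n * W powr \<alpha> \<le> lnorm x powr \<alpha>")
      case True
      have "1 * W powr \<alpha> \<le> real n * W powr \<alpha>" using n by (intro mult_right_mono) auto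
      then have "W powr \<alpha> \<le> lnorm x powr \<alpha>" using True by linarith
      then have "W \<le> lnorm x"
        using W_pos alpha powr_less_mono2[of \<alpha> "lnorm x" W] by (meson norm_ge_zero not_le)
      then have "P \<le> B * (Z + Y)"
        using off_diagonal[OF K n x True] by (simp add: P_def Z_def Y_def max_absorb1)
      moreover have "B * (Z + Y) \<le> (A + B) * (Z + Y)" and "A * (X + Y) \<le> (A + B) * (X + Y)"
        using A B 0 by (auto intro!: mult_right_mono)
      ultimately show ?thesis using on by linarith
    next
      case False
      define b where "b = real n powr (1 / \<alpha>) * W"
      have b: "0 < b" using W_pos n0 by (simp add: b_def)
      have ba: "b powr \<alpha> = real n * W powr \<alpha>"
        using W_pos n0 alpha by (simp add: b_def powr_mult powr_powr)
      have bd: "b powr ?d = real n powr (real ?d / \<alpha>) * W ^ ?d"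
        using W_pos n0 alpha by (simp add: b_def powr_mult powr_powr powr_realpow)
      have "lnorm x \<le> b"
      proof (rule ccontr)
        assume "\<not> ?thesis"
        then have "b powr \<alpha> \<le> lnorm x powr \<alpha>" using b alpha by (intro powr_mono2) auto
        then show False using False ba by simp
      qed
      moreover have "1 * W \<le> b"
        unfolding b_def using n alpha W_pos by (intro mult_right_mono ge_one_powr_ge_zero) auto
      ultimately have "max (lnorm x) W powr (real ?d + \<alpha>) \<le> b powr (real ?d + \<alpha>)"
        using alpha by (intro powr_mono2) (auto simp: le_max_iff_disj)
      then have "real n * W powr \<alpha> / b powr (real ?d + \<alpha>) \<le> Z"
        unfolding Z_def using W_pos b by (intro divide_left_mono mult_pos_pos) (auto simp: max_def)
      also have "real n * W powr \<alpha> / b powr (real ?d + \<alpha>) = X"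
        using n0 W_pos by (simp add: powr_add ba bd X_def)
      finally have "X \<le> Z" .
      then have "A * (X + Y) \<le> (A + B) * (Z + Y)" and "A * (X + Y) \<le> (A + B) * (X + Y)"
        using A B 0 by (auto intro!: mult_mono)
      then show ?thesis using on by linarith
    qed
    then show ?thesis
      unfolding P_def[symmetric] X_def[symmetric] Y_def[symmetric] Z_def[symmetric]
      by (simp add: min_def)
  qed
  moreover have "0 < A + B" using A B by simp
  ultimately show ?thesis by blast
qed

section \<open>The kernel of a stable-like profile\<close>

text \<open>Through the lower bound the profile dominates a constant on every box of radius \<open>W\<close>, and through the upper bound it
  is summable at scale \<open>W\<close>; together these fix the size of the normalising constant.\<close>

locale stable_profile =
  fixes f :: "real ^ 'd \<Rightarrow> real" and \<alpha> C1 C2 :: real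
  assumes alpha: "0 < \<alpha>" "\<alpha> < 2" and C1: "0 < C1" and C2: "0 < C2"
    and f_lower: "C1 * max (norm v) 1 powr (- real CARD('d) - \<alpha>) \<le> f v"
    and f_upper: "f v \<le> C2 * max (norm v) 1 powr (- real CARD('d) - \<alpha>)"
    and f_even: "f (- v) = f v"
begin

text \<open>A lower bound for the profile on the cube of side \<open>2\<close> around the origin, which is contained in the ball of
  radius \<open>sqrt d\<close>.\<close>

definition \<kappa> :: real where
  "\<kappa> = C1 * sqrt (real CARD('d)) powr (- real CARD('d) - \<alpha>)"

lemma kappa_pos: "0 < \<kappa>"
  using C1 by (simp add: \<kappa>_def)

lemma f_nonneg: "0 \<le> f v"
  by (rule order_trans[OF _ f_lower]) (use C1 in simp)

lemma f_le_const: "f v \<le> C2"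
proof -
  have "max (norm v) 1 powr (- real CARD('d) - \<alpha>) \<le> 1 powr (- real CARD('d) - \<alpha>)"
    using alpha by (intro powr_mono2') auto
  then have "C2 * max (norm v) 1 powr (- real CARD('d) - \<alpha>) \<le> C2 * 1"
    using C2 by (intro mult_left_mono) auto
  then show ?thesis using f_upper[of v] by simp
qed

lemma f_le_decay:
  assumes "0 < W" "x \<noteq> 0"
  shows "f (lattice_vec x /\<^sub>R W) \<le> C2 * W ^ CARD('d) * W powr \<alpha> * lnorm x powr (- real CARD('d) - \<alpha>)"
proof -
  have x: "0 < lnorm x" using assms by simp
  have "max (norm (lattice_vec x /\<^sub>R W)) 1 powr (- real CARD('d) - \<alpha>) \<le> (lnorm x / W) powr (- real CARD('d) - \<alpha>)"
    using alpha x assms by (intro powr_mono2') (auto simp: divide_inverse mult.commute)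
  also have "\<dots> = W ^ CARD('d) * W powr \<alpha> * lnorm x powr (- real CARD('d) - \<alpha>)"
    using x assms by (simp add: powr_divide powr_diff powr_minus powr_realpow field_simps)
  finally have "C2 * max (norm (lattice_vec x /\<^sub>R W)) 1 powr (- real CARD('d) - \<alpha>)
    \<le> C2 * (W ^ CARD('d) * W powr \<alpha> * lnorm x powr (- real CARD('d) - \<alpha>))"
    using C2 by (intro mult_left_mono) auto
  then show ?thesis using f_upper[of "lattice_vec x /\<^sub>R W"] by (simp add: mult_ac)
qed

lemma f_ge_on_box:
  assumes "0 < W" "W \<le> R" "\<And>i. \<bar>real_of_int (x $ i)\<bar> \<le> R"
  shows "\<kappa> * (R / W) powr (- real CARD('d) - \<alpha>) \<le> f (lattice_vec x /\<^sub>R W)"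
proof -
  let ?D = "sqrt (real CARD('d))"
  have D: "1 \<le> ?D" by simp
  have "lnorm x \<le> ?D * R" using assms by (intro lnorm_le_sqrt) auto
  then have "norm (lattice_vec x /\<^sub>R W) \<le> ?D * (R / W)"
    using assms by (simp add: field_simps)
  moreover have "1 * 1 \<le> ?D * (R / W)"
    using assms D by (intro mult_mono) auto
  ultimately have "(?D * (R / W)) powr (- real CARD('d) - \<alpha>) \<le> max (norm (lattice_vec x /\<^sub>R W)) 1 powr (- real CARD('d) - \<alpha>)"
    using alpha by (intro powr_mono2') auto
  then have "C1 * (?D * (R / W)) powr (- real CARD('d) - \<alpha>) \<le> f (lattice_vec x /\<^sub>R W)"
    using C1 by (intro order_trans[OF mult_left_mono f_lower]) auto
  moreover have "(?D * (R / W)) powr (- real CARD('d) - \<alpha>)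
      = ?D powr (- real CARD('d) - \<alpha>) * (R / W) powr (- real CARD('d) - \<alpha>)"
    by (rule powr_mult)
  ultimately show ?thesis by (simp add: \<kappa>_def mult.assoc)
qed

lemma Omega_ge:
  assumes "1 \<le> R" "R \<le> W" "4 * R \<le> real L"
  shows "\<kappa> * (R / 2) ^ CARD('d) \<le> Omega f L W"
proof -
  define B where "B = {x :: int ^ 'd. x \<noteq> 0 \<and> (\<forall>i. \<bar>real_of_int (x $ i)\<bar> \<le> R)}"
  have B: "B \<subseteq> lattice_box L - {0}"
  proof
    fix x assume x: "x \<in> B"
    have "\<bar>real_of_int (x $ i)\<bar> < real L / 2" for i
    proof -
      have "\<bar>real_of_int (x $ i)\<bar> \<le> R" using x by (simp add: B_def)
      then show ?thesis using assms by linarith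
    qed
    then show "x \<in> lattice_box L - {0}" using x by (auto simp: B_def intro: in_lattice_boxI)
  qed
  have "\<kappa> * (R / 2) ^ CARD('d) \<le> \<kappa> * card B"
    unfolding B_def using kappa_pos assms by (intro mult_left_mono card_punctured_box_ge) auto
  also have "\<dots> = (\<Sum>x\<in>B. \<kappa>)" by simp
  also have "\<dots> \<le> (\<Sum>x\<in>B. f (lattice_vec x /\<^sub>R W))"
  proof (rule sum_mono)
    fix x assume "x \<in> B"
    then show "\<kappa> \<le> f (lattice_vec x /\<^sub>R W)"
      using f_ge_on_box[of W W x] assms by (simp add: B_def) (meson order_trans)
  qed
  also have "\<dots> \<le> Omega f L W"
    unfolding Omega_def by (intro sum_mono2 B f_nonneg) (simp add: finite_lattice_box)
  finally show ?thesis .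
qed

lemma Omega_le:
  assumes T: "\<And>(A :: (int ^ 'd) set) R. finite A \<Longrightarrow> 0 < R \<Longrightarrow> (\<forall>x\<in>A. R < lnorm x) \<Longrightarrow>
      (\<Sum>x\<in>A. lnorm x powr (- real CARD('d) - \<alpha>)) \<le> T * R powr (- \<alpha>)"
    and "1 \<le> W"
  shows "Omega f L W \<le> C2 * (3 ^ CARD('d) + T) * W ^ CARD('d)"
proof -
  let ?d = "CARD('d)" and ?\<Lambda> = "lattice_box L - {0 :: int ^ 'd}"
  let ?N = "{x \<in> ?\<Lambda>. lnorm x \<le> W}" and ?F = "{x \<in> ?\<Lambda>. W < lnorm x}"
  let ?f = "\<lambda>x. f (lattice_vec x /\<^sub>R W)"
  have fin: "finite (lattice_box L :: (int ^ 'd) set)" by (rule finite_lattice_box)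
  have "Omega f L W = sum ?f ?N + sum ?f ?F"
    unfolding Omega_def using fin
    by (subst sum.union_disjoint[symmetric]) (auto intro!: sum.cong)
  also have "sum ?f ?N \<le> (\<Sum>x\<in>?N. C2)" by (intro sum_mono f_le_const)
  also have "\<dots> = C2 * card ?N" by simp
  also have "\<dots> \<le> C2 * (3 * W) ^ ?d"
  proof (rule mult_left_mono)
    have "card ?N \<le> card {x :: int ^ 'd. lnorm x \<le> W}"
      by (intro card_mono finite_lnorm_ball) auto
    then show "real (card ?N) \<le> (3 * W) ^ ?d"
      using card_lnorm_ball_le[where 'd = 'd, OF assms(2)] by linarith
  qed (use C2 in simp)
  also have "sum ?f ?F \<le> (\<Sum>x\<in>?F. C2 * W ^ ?d * W powr \<alpha> * lnorm x powr (- real ?d - \<alpha>))"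
    using assms(2) by (intro sum_mono f_le_decay) auto
  also have "\<dots> \<le> C2 * W ^ ?d * W powr \<alpha> * (T * W powr (- \<alpha>))"
    unfolding sum_distrib_left[symmetric]
    using C2 assms(2) fin by (intro mult_left_mono T) auto
  also have "C2 * (3 * W) ^ ?d + \<dots> = C2 * (3 ^ ?d + T) * W ^ ?d"
    using assms(2) by (simp add: powr_minus power_mult_distrib algebra_simps)
  finally show ?thesis by simp
qed

lemma step_nonneg: "0 \<le> step_matrix f L W x y"
  unfolding step_matrix_def Omega_def by (simp add: f_nonneg sum_nonneg)

lemma step_eq:
  assumes "0 < L" "x \<in> lattice_box L" "x \<noteq> 0"
  shows "step_matrix f L W 0 x = f (lattice_vec x /\<^sub>R W) / Omega f L W"
  using assms by (simp add: step_matrix_def lattice_rep_of_box)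

lemma step_le:
  assumes "0 < L" "x \<in> lattice_box L" "0 < K" "K \<le> Omega f L W"
  shows "step_matrix f L W 0 x \<le> C2 / K"
proof (cases "x = 0")
  case False
  have "f (lattice_vec x /\<^sub>R W) / Omega f L W \<le> C2 / K"
    using assms C2 by (intro frac_le f_le_const) auto
  then show ?thesis using step_eq assms False by simp
qed (use assms C2 in \<open>simp add: step_matrix_def\<close>)

lemma sum_step:
  assumes "0 < L" "0 < Omega f L W"
  shows "sum (step_matrix f L W 0) (lattice_box L) = 1"
proof -
  have z: "(0 :: int ^ 'd) \<in> lattice_box L" using assms(1) by (intro in_lattice_boxI) simp
  have "sum (step_matrix f L W 0) (lattice_box L) = (\<Sum>x\<in>lattice_box L - {0}. f (lattice_vec x /\<^sub>R W) / Omega f L W)"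
    using step_eq[OF assms(1)] z
    by (subst sum.remove[OF finite_lattice_box z]) (auto simp: step_matrix_def[of f L W 0 0] intro!: sum.cong)
  also have "\<dots> = 1"
    unfolding sum_divide_distrib[symmetric] Omega_def[symmetric] using assms by simp
  finally show ?thesis .
qed

text \<open>Dividing the two-sided bounds on the profile by the two-sided bounds on the normalising constant, both of order
  \<open>W\<^sup>d\<close>, gives kernel constants that depend on the profile only, and not on \<open>L\<close> and \<open>W\<close>.\<close>

lemma stable_kernel_step:
  "\<exists>c>0. \<exists>C>0. \<forall>L W. 1 \<le> W \<longrightarrow> 4 * W \<le> real L \<longrightarrow> stable_kernel \<alpha> c C L W (step_matrix f L W 0)"
proof -
  let ?d = "CARD('d)"
  obtain T where T: "0 < T" and tail: "\<And>(A :: (int ^ 'd) set) R. finite A \<Longrightarrow> 0 < R \<Longrightarrow> (\<forall>x\<in>A. R < lnorm x) \<Longrightarrow>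
      (\<Sum>x\<in>A. lnorm x powr (- real CARD('d) - \<alpha>)) \<le> T * R powr (- \<alpha>)"
    using tail_sum_le[OF alpha(1), where 'd = 'd] by blast
  define U where "U = C2 * (3 ^ ?d + T)"
  have U: "0 < U" using C2 T by (simp add: U_def add_pos_pos)
  define K where "K = \<kappa> / 2 ^ ?d"
  have K: "0 < K" using kappa_pos by (simp add: K_def)
  have "stable_kernel \<alpha> (\<kappa> / U) (C2 / K) L W (step_matrix f L W 0)" if W: "1 \<le> W" and L: "4 * W \<le> real L" for L W
  proof -
    have L0: "0 < L" using W L by (auto intro: gr0I)
    have \<Omega>_upper: "Omega f L W \<le> U * W ^ ?d"
      unfolding U_def by (rule Omega_le[OF tail W])
    have \<Omega>_lower: "K * W ^ ?d \<le> Omega f L W"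
      using Omega_ge[OF W order_refl L] by (simp add: K_def power_divide)
    have KW: "0 < K * W ^ ?d" using K W by simp
    then have \<Omega>: "0 < Omega f L W" using \<Omega>_lower by linarith
    show ?thesis
    proof
      show "step_matrix f L W 0 x \<le> C2 / K / W ^ ?d" if "x \<in> lattice_box L" for x
        using step_le[OF L0 that KW \<Omega>_lower] by simp
    next
      fix x :: "int ^ 'd" assume x: "x \<in> lattice_box L" "x \<noteq> 0"
      have "f (lattice_vec x /\<^sub>R W) / Omega f L W
        \<le> (C2 * W ^ ?d * W powr \<alpha> * lnorm x powr (- real ?d - \<alpha>)) / (K * W ^ ?d)"
        using x W KW \<Omega>_lower C2 by (intro frac_le f_le_decay) auto
      then show "step_matrix f L W 0 x \<le> C2 / K * W powr \<alpha> * lnorm x powr (- real ?d - \<alpha>)"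
        using step_eq[OF L0 x, of W] W by simp
    next
      fix x :: "int ^ 'd" and R
      assume x: "x \<in> lattice_box L" "x \<noteq> 0" and R: "W \<le> R" "\<And>i. \<bar>real_of_int (x $ i)\<bar> \<le> R"
      have "\<kappa> * (R / W) powr (- real ?d - \<alpha>) / (U * W ^ ?d) \<le> f (lattice_vec x /\<^sub>R W) / Omega f L W"
        using x R W \<Omega> \<Omega>_upper f_nonneg by (intro frac_le f_ge_on_box) auto
      moreover have "\<kappa> * (R / W) powr (- real ?d - \<alpha>) / (U * W ^ ?d) = \<kappa> / U * W powr \<alpha> * R powr (- real ?d - \<alpha>)"
        using W R by (simp add: powr_divide powr_diff powr_minus powr_realpow field_simps)
      ultimately show "\<kappa> / U * W powr \<alpha> * R powr (- real ?d - \<alpha>) \<le> step_matrix f L W 0 x"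
        using step_eq[OF L0 x, of W] by simp
    next
      fix x :: "int ^ 'd" assume x: "x \<in> lattice_box L" "- x \<in> lattice_box L"
      show "step_matrix f L W 0 (- x) = step_matrix f L W 0 x"
        using x L0 by (simp add: step_matrix_def lattice_rep_of_box lattice_vec_uminus f_even)
    qed (use alpha kappa_pos U C2 K W L step_nonneg sum_step[OF L0 \<Omega>] in auto)
  qed
  moreover have "0 < \<kappa> / U" "0 < C2 / K" using kappa_pos U C2 K by auto
  ultimately show ?thesis by blast
qed

text \<open>When the range of the walk is comparable to the box or exceeds it, one step already spreads the walk over the whole
  box.\<close>

lemma trans_prob_le_if_wide:
  assumes "4 \<le> L" "real L \<le> 4 * W" "1 \<le> n" "x \<in> lattice_box L"
  shows "trans_prob f L W n 0 x \<le> C2 * 8 ^ CARD('d) / \<kappa> * (1 / real L ^ CARD('d))"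
proof -
  let ?d = "CARD('d)" and ?q = "step_matrix f L W 0"
  define K where "K = \<kappa> * (real L / 8) ^ ?d"
  have L0: "0 < L" using assms by simp
  have K: "0 < K" using kappa_pos L0 by (simp add: K_def)
  have \<Omega>: "K \<le> Omega f L W"
    using Omega_ge[of "real L / 4" W L] assms by (simp add: K_def)
  obtain m where n: "n = Suc m" using assms(3) by (cases n) auto
  have z: "(0 :: int ^ 'd) \<in> lattice_box L" using L0 by (intro in_lattice_boxI) simp
  have r1: "(\<Sum>y\<in>lattice_box L. residue_ind L x (z + y)) \<le> 1" for z :: "int ^ 'd"
    using sum_residue_ind[OF L0, of "\<lambda>_. 1" x z] by simp
  have "trans_prob f L W n 0 x = walk_op L ?q ((walk_op L ?q ^^ m) (residue_ind L x)) 0"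
    by (simp add: trans_prob_eq_walk_op[OF L0 z assms(4)] n del: trans_prob.simps)
  also have "\<dots> \<le> C2 / K * 1"
  proof (rule walk_op_le_sup_times_mass)
    show "?q y \<le> C2 / K" if "y \<in> lattice_box L" for y by (rule step_le[OF L0 that K \<Omega>])
    show "0 \<le> (walk_op L ?q ^^ m) (residue_ind L x) z" for z
      using walk_op_pow_mono[of L ?q ?q "residue_ind L x" "residue_ind L x"] step_nonneg
      by (simp add: residue_ind_def)
    show "(\<Sum>y\<in>lattice_box L. (walk_op L ?q ^^ m) (residue_ind L x) (0 + y)) \<le> 1"
      using K \<Omega> by (intro walk_op_pow_mass step_nonneg r1) (auto simp: sum_step[OF L0])
  qed (use C2 K in auto)
  also have "C2 / K * 1 = C2 * 8 ^ ?d / \<kappa> * (1 / real L ^ ?d)"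
    by (simp add: K_def power_divide)
  finally show ?thesis .
qed

end

theorem proposition1p4:
  fixes f :: "real ^ 'd \<Rightarrow> real" and \<alpha> :: real and x0 :: "real ^ 'd"
  assumes "0 < \<alpha>" and "\<alpha> < 2"
    and "symmetric_prob_density f"
    and "continuous (at x0) f" and "f x0 > 0"
    and "comparable f (\<lambda>x. (max (norm x) 1) powr (- real CARD('d) - \<alpha>))"
  shows "\<exists>C>0. \<exists>(L0::nat) (W0::real). \<forall>L\<ge>L0. \<forall>W\<ge>W0.
           (\<forall>i. 0 \<le> x0 $ i \<and> x0 $ i < real L / (2 * W)) \<longrightarrow>
           (\<forall>n::nat. \<forall>x \<in> lattice_box L. n \<ge> 1 \<longrightarrow>
              trans_prob f L W n 0 x \<le>
                C * (min (1 / (real n powr (real CARD('d) / \<alpha>) * W ^ CARD('d)))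
                         (real n * W powr \<alpha> / (max (norm (lattice_vec x)) W) powr (real CARD('d) + \<alpha>))
                     + 1 / real L ^ CARD('d)))"
proof -
  let ?d = "CARD('d)"
  obtain C1 C2 where C: "0 < C1" "0 < C2" "\<And>x. C1 * max (norm x) 1 powr (- real ?d - \<alpha>) \<le> f x"
      "\<And>x. f x \<le> C2 * max (norm x) 1 powr (- real ?d - \<alpha>)"
    using assms(6) unfolding comparable_def by blast
  interpret stable_profile f \<alpha> C1 C2
    using assms C by unfold_locales (auto simp: symmetric_prob_density_def)
  obtain c K where cK: "0 < c" "0 < K" and kernel: "\<And>L W. 1 \<le> W \<Longrightarrow> 4 * W \<le> real L \<Longrightarrow>
      stable_kernel \<alpha> c K L W (step_matrix f L W 0)"
    using stable_kernel_step by blast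
  obtain A where A: "0 < A" and bound: "\<And>L W (q :: int ^ 'd \<Rightarrow> real) n x.
      stable_kernel \<alpha> c K L W q \<Longrightarrow> 1 \<le> n \<Longrightarrow> x \<in> lattice_box L \<Longrightarrow>
      (walk_op L q ^^ n) (residue_ind L x) 0
      \<le> A * (min (1 / (real n powr (real ?d / \<alpha>) * W ^ ?d))
                  (real n * W powr \<alpha> / (max (lnorm x) W) powr (real ?d + \<alpha>)) + 1 / real L ^ ?d)"
    using heat_kernel_bound[OF assms(1,2) cK, where 'd = 'd] by blast
  define B where "B = C2 * 8 ^ ?d / \<kappa>"
  have B: "0 < B" using C2 kappa_pos by (simp add: B_def)
  have main: "trans_prob f L W n 0 x \<le> (A + B) *
      (min (1 / (real n powr (real ?d / \<alpha>) * W ^ ?d))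
           (real n * W powr \<alpha> / (max (lnorm x) W) powr (real ?d + \<alpha>)) + 1 / real L ^ ?d)"
      (is "_ \<le> (A + B) * (?m + ?Y)")
    if L: "4 \<le> L" and W: "1 \<le> W" and n: "1 \<le> n" and x: "x \<in> lattice_box L" for L W n x
  proof -
    have m: "0 \<le> ?m" and Y: "0 \<le> ?Y" using W by auto
    have z: "(0 :: int ^ 'd) \<in> lattice_box L" using L by (intro in_lattice_boxI) simp
    show ?thesis
    proof (cases "4 * W \<le> real L")
      case True
      have "trans_prob f L W n 0 x \<le> A * (?m + ?Y)"
        using bound[OF kernel[OF W True] n x] trans_prob_eq_walk_op[of L 0 x f W n] L z x by simp
      also have "\<dots> \<le> (A + B) * (?m + ?Y)" using B m Y by (intro mult_right_mono) auto
      finally show ?thesis .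
    next
      case False
      have "trans_prob f L W n 0 x \<le> B * ?Y"
        unfolding B_def using False by (intro trans_prob_le_if_wide L n x) auto
      also have "\<dots> \<le> (A + B) * (?m + ?Y)" using A B m Y by (intro mult_mono) auto
      finally show ?thesis .
    qed
  qed
  have "0 < A + B" using A B by simp
  \<comment> \<open>\<open>W \<ge> 1\<close> and \<open>L \<ge> 4\<close> are what makes boxes of radius \<open>min W (L/4)\<close> reach beyond the origin\<close>
  show ?thesis
  proof (rule exI[of _ "A + B"], rule conjI[OF \<open>0 < A + B\<close>], rule exI[of _ "4 :: nat"],
      rule exI[of _ "1 :: real"], intro allI impI ballI)
    fix L n :: nat and W :: real and x :: "int ^ 'd"
    assume "4 \<le> L" "1 \<le> W" "x \<in> lattice_box L" "1 \<le> n"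
    then show "trans_prob f L W n 0 x \<le> (A + B) *
      (min (1 / (real n powr (real ?d / \<alpha>) * W ^ ?d))
           (real n * W powr \<alpha> / (max (lnorm x) W) powr (real ?d + \<alpha>)) + 1 / real L ^ ?d)"
      by (intro main)
  qed
qed

end
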